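(* Let $r>0$ and let $s\ge2$ be an integer. Write $n_\varepsilon:=n_\varepsilon(U^{r,a}(\mathbb I^s,w),L_2(\mathbb I^s,w))$. Then for every $a>1/2$ there is an $\varepsilon^*=\varepsilon^*(s,a)\in(0,1]$ such that for every $\varepsilon\in(0,\varepsilon^*]$, $$n_\varepsilon\ \le\ \frac{\varepsilon^{-1/r}\bigl(\ln\varepsilon^{-1/r}-s\ln(a-1/2)\bigr)^s}{(s-1)!\,\bigl(\ln\varepsilon^{-1/r}+s(1-\ln(a-1/2))-1\bigr)};$$ for every $a>1$ and every $\varepsilon\in(0,(a-1)^{-sr})$, $$n_\varepsilon\ \le\ \frac{\varepsilon^{-1/r}\bigl(\ln\varepsilon^{-1/r}-s\ln(a-1)\bigr)^s}{(s-1)!\,\bigl(\ln\varepsilon^{-1/r}+s(1-\ln(a-1))-1\bigr)};$$ and for every $a>0$ and every $\varepsilon\in(0,a^{-sr})$, $$n_\varepsilon\ \ge\ \frac{\varepsilon^{-1/r}\bigl(\ln\varepsilon^{-1/r}-s\ln a\bigr)^s}{(s-1)!\,\bigl(\ln\varepsilon^{-1/r}+s(1-\ln a)\bigr)}-1.$$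
   Context: $\mathbb N_0=\{0,1,2,\dots\}$, $\mathbb I^s=[-1,1]^s$. Given $\alpha,\beta>-1$, let $a:=(\alpha+\beta+1)/2$, assumed positive. $L_2(\mathbb I^s,w)$ is the Hilbert space with inner product $(f,g)_w=\int_{\mathbb I^s}f(\mathbf x)g(\mathbf x)w(\mathbf x)\,d\mathbf x$, where $w(\mathbf x)=\prod_{j=1}^s(1-x_j)^\alpha(1+x_j)^\beta$. $\{P^{(\alpha,\beta)}_k\}_{k\ge0}$ are the orthonormal Jacobi polynomials on $[-1,1]$ for the weight $(1-x)^\alpha(1+x)^\beta$; $P^{(\alpha,\beta)}_{\mathbf k}(\mathbf x)=\prod_{j=1}^sP^{(\alpha,\beta)}_{k_j}(x_j)$ for $\mathbf k\in\mathbb N_0^s$, and $f_{\mathbf k}=(f,P^{(\alpha,\beta)}_{\mathbf k})_w$. With $\lambda_a(\mathbf k):=\prod_{j=1}^s(a+k_j)$, $K^{r,a}(\mathbb I^s,w)$ is the space of $f\in L_2(\mathbb I^s,w)$ with finite norm $\|f\|_{K^{r,a}(\mathbb I^s,w)}=\bigl(\sum_{\mathbf k\in\mathbb N_0^s}\lambda_a(\mathbf k)^{2r}|f_{\mathbf k}|^2\bigr)^{1/2}$, and $U^{r,a}(\mathbb I^s,w)$ is its (closed) unit ball. For a normed space $X$ and $W\subset X$ centrally symmetric, $n_\varepsilon(W,X)$ is the smallest $n\in\mathbb N_0$ such that some linear subspace $L\subset X$ of dimension $\le n$ satisfies $\sup_{f\in W}\inf_{g\in L}\|f-g\|_X\le\varepsilon$.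 The value $r$ is fixed before $\varepsilon^*$ is chosen. *)

theory Defs
  imports
    "HOL-Analysis.Analysis"
    "HOL-Library.Function_Algebras"
    "HOL-Library.Extended_Nat"
    "HOL-Computational_Algebra.Polynomial"
begin

instantiation "fun" :: (type, real_vector) real_vector
begin

definition scaleR_fun :: "real \<Rightarrow> ('a \<Rightarrow> 'b) \<Rightarrow> 'a \<Rightarrow> 'b"
  where "scaleR_fun c f = (\<lambda>x. c *\<^sub>R f x)"

instance
  by standard (auto simp: scaleR_fun_def fun_eq_iff scaleR_add_right scaleR_add_left)

end


(* For a negative exponent the value at the corresponding endpoint is 0 rather than infinity
   (0 powr e = 0); this affects only a null set. *)
definition jacobi_weight :: "real \<Rightarrow> real \<Rightarrow> real \<Rightarrow> real" where
  "jacobi_weight \<alpha> \<beta> x = (1 - x) powr \<alpha> * (1 + x) powr \<beta>"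

definition poly_inner :: "real \<Rightarrow> real \<Rightarrow> real poly \<Rightarrow> real poly \<Rightarrow> real" where
  "poly_inner \<alpha> \<beta> p q = (LINT x:{-1..1}|lborel. poly p x * poly q x * jacobi_weight \<alpha> \<beta> x)"

(* Orthonormality determines these polynomials up to sign; as usual the sign is fixed
   by a positive leading coefficient. The defining property has exactly one solution:
   see jacobi_ex1 below. *)
definition is_jacobi :: "real \<Rightarrow> real \<Rightarrow> nat \<Rightarrow> real poly \<Rightarrow> bool" where
  "is_jacobi \<alpha> \<beta> k p \<longleftrightarrow> degree p = k \<and> lead_coeff p > 0 \<and>
     poly_inner \<alpha> \<beta> p p = 1 \<and> (\<forall>q. degree q < k \<longrightarrow> poly_inner \<alpha> \<beta> p q = 0)"

definition jacobi :: "real \<Rightarrow> real \<Rightarrow> nat \<Rightarrow> real poly" where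
  "jacobi \<alpha> \<beta> k = (THE p. is_jacobi \<alpha> \<beta> k p)"


definition unit_cube :: "(real ^ 's) set" where
  "unit_cube = {x. \<forall>j. x $ j \<in> {-1..1}}"

definition weight_measure :: "real \<Rightarrow> real \<Rightarrow> (real ^ 's) measure" where
  "weight_measure \<alpha> \<beta> =
     density (restrict_space lborel unit_cube) (\<lambda>x. ennreal (\<Prod>j\<in>UNIV. jacobi_weight \<alpha> \<beta> (x $ j)))"

(* L2 is modelled by representatives: its elements are functions, not classes of functions,
   and norm_w is a seminorm vanishing exactly on the functions that are zero almost everywhere
   in the cube. The values of a function outside the cube play no role. *)
definition L2 :: "real \<Rightarrow> real \<Rightarrow> (real ^ 's \<Rightarrow> real) set" where
  "L2 \<alpha> \<beta> = {f \<in> borel_measurable (weight_measure \<alpha> \<beta>).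
               integrable (weight_measure \<alpha> \<beta>) (\<lambda>x. (f x)\<^sup>2)}"

definition inner_w :: "real \<Rightarrow> real \<Rightarrow> (real ^ 's \<Rightarrow> real) \<Rightarrow> (real ^ 's \<Rightarrow> real) \<Rightarrow> real" where
  "inner_w \<alpha> \<beta> f g = (\<integral>x. f x * g x \<partial>weight_measure \<alpha> \<beta>)"

definition norm_w :: "real \<Rightarrow> real \<Rightarrow> (real ^ 's \<Rightarrow> real) \<Rightarrow> real" where
  "norm_w \<alpha> \<beta> f = sqrt (inner_w \<alpha> \<beta> f f)"

definition jacobi_prod :: "real \<Rightarrow> real \<Rightarrow> nat ^ 's \<Rightarrow> real ^ 's \<Rightarrow> real" where
  "jacobi_prod \<alpha> \<beta> k x = (\<Prod>j\<in>UNIV. poly (jacobi \<alpha> \<beta> (k $ j)) (x $ j))"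

definition jacobi_coeff :: "real \<Rightarrow> real \<Rightarrow> (real ^ 's \<Rightarrow> real) \<Rightarrow> nat ^ 's \<Rightarrow> real" where
  "jacobi_coeff \<alpha> \<beta> f k = inner_w \<alpha> \<beta> f (jacobi_prod \<alpha> \<beta> k)"

definition lam :: "real \<Rightarrow> nat ^ 's \<Rightarrow> real" where
  "lam a k = (\<Prod>j\<in>UNIV. a + real (k $ j))"

definition K_space :: "real \<Rightarrow> real \<Rightarrow> real \<Rightarrow> real \<Rightarrow> (real ^ 's \<Rightarrow> real) set" where
  "K_space r a \<alpha> \<beta> = {f \<in> L2 \<alpha> \<beta>.
     (\<lambda>k. lam a k powr (2 * r) * \<bar>jacobi_coeff \<alpha> \<beta> f k\<bar>\<^sup>2) summable_on UNIV}"

definition K_norm :: "real \<Rightarrow> real \<Rightarrow> real \<Rightarrow> real \<Rightarrow> (real ^ 's \<Rightarrow> real) \<Rightarrow> real" where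
  "K_norm r a \<alpha> \<beta> f = sqrt (\<Sum>\<^sub>\<infinity>k. lam a k powr (2 * r) * \<bar>jacobi_coeff \<alpha> \<beta> f k\<bar>\<^sup>2)"

definition U_ball :: "real \<Rightarrow> real \<Rightarrow> real \<Rightarrow> real \<Rightarrow> (real ^ 's \<Rightarrow> real) set" where
  "U_ball r a \<alpha> \<beta> = {f \<in> K_space r a \<alpha> \<beta>. K_norm r a \<alpha> \<beta> f \<le> 1}"


(* X is a subspace of the ambient vector space, with (semi)norm N. The requirement that L has a
   finite spanning set is needed because dim is 0 on infinite-dimensional subspaces. If N is only
   a seminorm, the value is the same as for the normed space X/{N = 0}: a finite-dimensional
   subspace of the quotient lifts to one of X of equal dimension, and passing to the quotient
   does not increase dimension. The infimum is infinity if no n is admissible, and otherwise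
   the smallest admissible n. *)
definition n_eps :: "('v::real_vector \<Rightarrow> real) \<Rightarrow> 'v set \<Rightarrow> 'v set \<Rightarrow> real \<Rightarrow> enat" where
  "n_eps N W X \<epsilon> = Inf {enat n | n. \<exists>L. subspace L \<and> L \<subseteq> X \<and> (\<exists>B. finite B \<and> span B = L) \<and> dim L \<le> n \<and>
      (SUP f\<in>W. INF g\<in>L. ereal (N (f - g))) \<le> ereal \<epsilon>}"


lemma jacobi_weight_nonneg: "jacobi_weight \<alpha> \<beta> x \<ge> 0"
  by (simp add: jacobi_weight_def)

lemma jacobi_weight_measurable [measurable]: "jacobi_weight \<alpha> \<beta> \<in> borel_measurable borel"
  unfolding jacobi_weight_def[abs_def] by measurable

lemma jacobi_weight_integrable:
  assumes "\<alpha> > -1" "\<beta> > -1"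
  shows "set_integrable lborel {-1..1} (jacobi_weight \<alpha> \<beta>)"
proof -
  have "set_integrable lborel {0..1} (\<lambda>t::real. t powr (\<beta> + 1 - 1) * (1 - t) powr (\<alpha> + 1 - 1))"
    using assms by (intro integrable_Beta) auto
  then have "integrable lborel (\<lambda>t::real. indicator {0..1} t * (t powr \<beta> * (1 - t) powr \<alpha>))"
    by (simp add: set_integrable_def)
  from lborel_integrable_real_affine[OF this, of "1/2" "1/2"]
  have "integrable lborel (\<lambda>x::real. 2 powr (\<alpha> + \<beta>) * (indicator {0..1} (1/2 + 1/2 * x) *
      ((1/2 + 1/2 * x) powr \<beta> * (1 - (1/2 + 1/2 * x)) powr \<alpha>)))"
    by (intro integrable_mult_right) simp
  also have "(\<lambda>x::real. 2 powr (\<alpha> + \<beta>) * (indicator {0..1} (1/2 + 1/2 * x) *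
      ((1/2 + 1/2 * x) powr \<beta> * (1 - (1/2 + 1/2 * x)) powr \<alpha>)))
    = (\<lambda>x. indicat_real {-1..1} x * jacobi_weight \<alpha> \<beta> x)"
  proof
    fix x :: real
    show "2 powr (\<alpha> + \<beta>) * (indicator {0..1} (1/2 + 1/2 * x) *
      ((1/2 + 1/2 * x) powr \<beta> * (1 - (1/2 + 1/2 * x)) powr \<alpha>))
      = indicat_real {-1..1} x * jacobi_weight \<alpha> \<beta> x"
    proof (cases "x \<in> {-1..1}")
      case True
      have 1: "1/2 + 1/2 * x = (1 + x) / 2" "1 - (1 + x) / 2 = (1 - x) / 2"
        by (auto simp: field_simps)
      have 2: "((1 + x) / 2) powr \<beta> = (1 + x) powr \<beta> / 2 powr \<beta>"
        "((1 - x) / 2) powr \<alpha> = (1 - x) powr \<alpha> / 2 powr \<alpha>"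
        using True by (auto intro!: powr_divide)
      have "indicat_real {0..1} ((1 + x) / 2) = 1" using True by auto
      then show ?thesis using True unfolding 1 2
        by (simp add: jacobi_weight_def powr_add)
    next
      case False
      then have "1/2 + 1/2 * x \<notin> {0..1}" by (auto simp: field_simps)
      then show ?thesis using False by simp
    qed
  qed
  finally show ?thesis by (simp add: set_integrable_def)
qed

lemma poly_weight_integrable:
  assumes "\<alpha> > -1" "\<beta> > -1"
  shows "set_integrable lborel {-1..1} (\<lambda>x. poly p x * jacobi_weight \<alpha> \<beta> x)"
proof -
  have "compact (poly p ` {-1..1::real})"
    by (intro compact_continuous_image continuous_intros) auto
  then have "bounded (poly p ` {-1..1})" by (rule compact_imp_bounded)
  then obtain B where "\<forall>y \<in> poly p ` {-1..1}. norm y \<le> B" unfolding bounded_iff by blast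
  then have B: "\<And>x. x \<in> {-1..1} \<Longrightarrow> \<bar>poly p x\<bar> \<le> B" by auto
  have "set_integrable lborel {-1..1} (\<lambda>x. B * jacobi_weight \<alpha> \<beta> x)"
    using jacobi_weight_integrable[OF assms] by simp
  then show ?thesis unfolding set_integrable_def
  proof (rule Bochner_Integration.integrable_bound)
    have [measurable]: "poly p \<in> borel_measurable borel"
      by (intro borel_measurable_continuous_onI continuous_intros)
    show "(\<lambda>x. indicat_real {-1..1} x *\<^sub>R (poly p x * jacobi_weight \<alpha> \<beta> x)) \<in> borel_measurable lborel"
      by measurable
    have "\<bar>poly p x * jacobi_weight \<alpha> \<beta> x\<bar> \<le> \<bar>B * jacobi_weight \<alpha> \<beta> x\<bar>" if "x \<in> {-1..1}" for x
      using B[OF that] by (simp add: abs_mult mult_right_mono)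
    then show "AE x in lborel. norm (indicat_real {-1..1} x *\<^sub>R (poly p x * jacobi_weight \<alpha> \<beta> x))
      \<le> norm (indicat_real {-1..1} x *\<^sub>R (B * jacobi_weight \<alpha> \<beta> x))"
      by (auto simp: indicator_def)
  qed
qed

lemma poly_inner_commute: "poly_inner \<alpha> \<beta> p q = poly_inner \<alpha> \<beta> q p"
  by (simp add: poly_inner_def mult.commute)

lemma poly_inner_alt: "poly_inner \<alpha> \<beta> p q = (LINT x:{-1..1}|lborel. poly (p * q) x * jacobi_weight \<alpha> \<beta> x)"
  by (simp add: poly_inner_def)

lemma poly_inner_add_left:
  assumes "\<alpha> > -1" "\<beta> > -1"
  shows "poly_inner \<alpha> \<beta> (p + p') q = poly_inner \<alpha> \<beta> p q + poly_inner \<alpha> \<beta> p' q"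
  unfolding poly_inner_alt
  by (simp add: distrib_right set_integral_add poly_weight_integrable[OF assms] flip: poly_mult)

lemma poly_inner_smult_left: "poly_inner \<alpha> \<beta> (smult c p) q = c * poly_inner \<alpha> \<beta> p q"
  by (simp add: poly_inner_def mult.assoc)

lemma poly_inner_smult_right: "poly_inner \<alpha> \<beta> p (smult c q) = c * poly_inner \<alpha> \<beta> p q"
  using poly_inner_smult_left poly_inner_commute by metis

lemma poly_inner_diff_left:
  assumes "\<alpha> > -1" "\<beta> > -1"
  shows "poly_inner \<alpha> \<beta> (p - p') q = poly_inner \<alpha> \<beta> p q - poly_inner \<alpha> \<beta> p' q"
  using poly_inner_add_left[OF assms, of p "smult (-1) p'" q]
    poly_inner_smult_left[of \<alpha> \<beta> "-1" p' q] by simp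

lemma poly_inner_add_right:
  assumes "\<alpha> > -1" "\<beta> > -1"
  shows "poly_inner \<alpha> \<beta> q (p + p') = poly_inner \<alpha> \<beta> q p + poly_inner \<alpha> \<beta> q p'"
  using poly_inner_add_left[OF assms] poly_inner_commute by metis

lemma poly_inner_diff_right:
  assumes "\<alpha> > -1" "\<beta> > -1"
  shows "poly_inner \<alpha> \<beta> q (p - p') = poly_inner \<alpha> \<beta> q p - poly_inner \<alpha> \<beta> q p'"
  using poly_inner_diff_left[OF assms] poly_inner_commute by metis

lemma poly_inner_self_nonneg: "poly_inner \<alpha> \<beta> p p \<ge> 0"
  unfolding poly_inner_def set_lebesgue_integral_def
  by (intro Bochner_Integration.integral_nonneg) (simp add: jacobi_weight_nonneg)

lemma poly_inner_self_eq_0: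
  assumes "\<alpha> > -1" "\<beta> > -1" "poly_inner \<alpha> \<beta> p p = 0"
  shows "p = 0"
proof (rule ccontr)
  assume "p \<noteq> 0"
  then have fin: "finite {x. poly p x = 0}" by (rule poly_roots_finite)
  have "integrable lborel (\<lambda>x. indicat_real {-1..1} x *\<^sub>R (poly (p * p) x * jacobi_weight \<alpha> \<beta> x))"
    using poly_weight_integrable[OF assms(1,2)] unfolding set_integrable_def .
  then have "AE x in lborel. indicat_real {-1..1} x *\<^sub>R (poly (p * p) x * jacobi_weight \<alpha> \<beta> x) = 0"
    using assms(3) unfolding poly_inner_alt set_lebesgue_integral_def
    by (subst (asm) integral_nonneg_eq_0_iff_AE) (auto simp: jacobi_weight_nonneg)
  moreover have "AE x in lborel. x \<notin> {x. poly p x = 0}"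
    by (rule AE_not_in) (simp add: finite_imp_null_set_lborel fin)
  ultimately have "AE x::real in lborel. x \<notin> {-1<..<1}"
  proof eventually_elim
    case (elim x)
    have "jacobi_weight \<alpha> \<beta> x > 0" if "x \<in> {-1<..<1}"
      using that by (simp add: jacobi_weight_def)
    then show ?case using elim by (auto simp: indicator_def)
  qed
  moreover have "{x. \<not> x \<notin> {-1<..<1::real}} = {-1<..<1}" by auto
  ultimately have "{-1<..<1::real} \<in> null_sets lborel"
    by (subst (asm) AE_iff_null) (auto simp del: greaterThanLessThan_iff)
  then have "emeasure lborel {-1<..<1::real} = 0" by auto
  then show False by simp
qed

lemma poly_projection:
  assumes ab: "\<alpha> > -1" "\<beta> > -1"
  shows "\<exists>q. (\<forall>i\<ge>n. coeff q i = 0) \<and>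
    (\<forall>g. (\<forall>i\<ge>n. coeff g i = 0) \<longrightarrow> poly_inner \<alpha> \<beta> (f - q) g = 0)"
proof (induction n arbitrary: f)
  case 0
  have "poly_inner \<alpha> \<beta> p 0 = 0" for p by (simp add: poly_inner_def)
  moreover have "(\<forall>i\<ge>0. coeff g i = 0) \<longleftrightarrow> g = 0" for g :: "real poly" by (auto simp: poly_eq_iff)
  ultimately show ?case by auto
next
  case (Suc n)
  from Suc[of "monom 1 n"] obtain q0 where
    q0: "\<And>i. i \<ge> n \<Longrightarrow> coeff q0 i = 0"
      "\<And>g. (\<And>i. i \<ge> n \<Longrightarrow> coeff g i = 0) \<Longrightarrow> poly_inner \<alpha> \<beta> (monom 1 n - q0) g = 0" by blast
  define e where "e = monom 1 n - q0"
  have e: "coeff e n = 1" "\<And>i. i > n \<Longrightarrow> coeff e i = 0" using q0(1) by (auto simp: e_def)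
  then have "poly_inner \<alpha> \<beta> e e \<noteq> 0" using poly_inner_self_eq_0[OF ab, of e] by auto
  from Suc[of f] obtain q where
    q: "\<And>i. i \<ge> n \<Longrightarrow> coeff q i = 0"
      "\<And>g. (\<And>i. i \<ge> n \<Longrightarrow> coeff g i = 0) \<Longrightarrow> poly_inner \<alpha> \<beta> (f - q) g = 0" by blast
  define c where "c = poly_inner \<alpha> \<beta> (f - q) e / poly_inner \<alpha> \<beta> e e"
  show ?case
  proof (intro exI[of _ "q + smult c e"] conjI allI impI)
    show "coeff (q + smult c e) i = 0" if "i \<ge> Suc n" for i using that q e by auto
    fix g :: "real poly" assume g: "\<forall>i\<ge>Suc n. coeff g i = 0"
    define h where "h = g - smult (coeff g n) e"
    have h: "coeff h i = 0" if "i \<ge> n" for i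
      using that g e by (cases "i = n") (auto simp: h_def)
    have "f - (q + smult c e) = (f - q) - smult c e" by simp
    moreover have "poly_inner \<alpha> \<beta> ((f - q) - smult c e) h = 0"
      using q(2)[OF h] q0(2)[OF h]
      by (simp add: poly_inner_diff_left[OF ab] poly_inner_smult_left e_def)
    moreover have "poly_inner \<alpha> \<beta> ((f - q) - smult c e) e = 0"
      using \<open>poly_inner \<alpha> \<beta> e e \<noteq> 0\<close>
      by (simp only: poly_inner_diff_left[OF ab, of "f - q"] poly_inner_smult_left) (simp add: c_def)
    moreover have "g = h + smult (coeff g n) e" by (simp add: h_def)
    ultimately show "poly_inner \<alpha> \<beta> (f - (q + smult c e)) g = 0"
      by (metis poly_inner_add_right[OF ab] poly_inner_smult_right mult_zero_right add_0)
  qed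
qed

lemma jacobi_ex1:
  assumes ab: "\<alpha> > -1" "\<beta> > -1"
  shows "\<exists>!p. is_jacobi \<alpha> \<beta> k p"
proof (rule ex_ex1I)
  obtain q where q: "\<And>i. i \<ge> k \<Longrightarrow> coeff q i = 0"
      "\<And>g. (\<And>i. i \<ge> k \<Longrightarrow> coeff g i = 0) \<Longrightarrow> poly_inner \<alpha> \<beta> (monom 1 k - q) g = 0"
    using poly_projection[OF ab, of k "monom 1 k"] by blast
  define e where "e = monom 1 k - q"
  have e: "coeff e k = 1" "\<And>i. i > k \<Longrightarrow> coeff e i = 0" using q(1) by (auto simp: e_def)
  have deg: "degree e = k"
    by (rule antisym) (use e in \<open>auto intro!: degree_le le_degree\<close>)
  have "poly_inner \<alpha> \<beta> e e \<noteq> 0" using poly_inner_self_eq_0[OF ab, of e] e(1) by auto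
  with poly_inner_self_nonneg[of \<alpha> \<beta> e] have pos: "poly_inner \<alpha> \<beta> e e > 0" by simp
  define c where "c = 1 / sqrt (poly_inner \<alpha> \<beta> e e)"
  have "c > 0" using pos by (simp add: c_def)
  have "poly_inner \<alpha> \<beta> e g = 0" if "degree g < k" for g
    unfolding e_def by (rule q(2)) (use that in \<open>auto intro: coeff_eq_0\<close>)
  moreover have "c * (c * poly_inner \<alpha> \<beta> e e) = 1"
    using pos by (simp add: c_def field_simps)
  ultimately have "is_jacobi \<alpha> \<beta> k (smult c e)"
    using \<open>c > 0\<close> deg e by (simp add: is_jacobi_def poly_inner_smult_left poly_inner_smult_right)
  then show "\<exists>p. is_jacobi \<alpha> \<beta> k p" ..
next
  fix p p' assume p: "is_jacobi \<alpha> \<beta> k p" and p': "is_jacobi \<alpha> \<beta> k p'"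
  define b where "b = coeff p k" define b' where "b' = coeff p' k"
  have bpos: "b > 0" "b' > 0" using p p' by (auto simp: is_jacobi_def b_def b'_def)
  define d where "d = smult b' p - smult b p'"
  have "d = 0 \<or> degree d < k"
  proof (rule ccontr)
    assume *: "\<not> (d = 0 \<or> degree d < k)"
    have "degree d \<le> k" unfolding d_def
      using p p' by (intro degree_diff_le) (auto simp: is_jacobi_def)
    then have "degree d = k" using * by auto
    moreover have "coeff d k = 0" by (simp add: d_def b_def b'_def)
    ultimately show False using * leading_coeff_0_iff[of d] by simp
  qed
  then have "poly_inner \<alpha> \<beta> p d = 0 \<and> poly_inner \<alpha> \<beta> p' d = 0"
    using p p' by (auto simp: is_jacobi_def) (simp_all add: poly_inner_def)
  then have "poly_inner \<alpha> \<beta> d d = 0"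
    by (subst d_def) (simp add: poly_inner_diff_left[OF ab] poly_inner_smult_left)
  then have "d = 0" by (rule poly_inner_self_eq_0[OF ab])
  then have eq: "smult b' p = smult b p'" by (simp add: d_def)
  have "b' * (b' * poly_inner \<alpha> \<beta> p p) = b * (b * poly_inner \<alpha> \<beta> p' p')"
    using arg_cong[OF eq, of "\<lambda>u. poly_inner \<alpha> \<beta> u u"]
    by (simp add: poly_inner_smult_left poly_inner_smult_right)
  then have "b'\<^sup>2 = b\<^sup>2" using p p' by (simp add: is_jacobi_def power2_eq_square)
  then have "b = b'" using bpos by (simp add: power2_eq_iff_nonneg)
  with eq bpos show "p = p'" by (metis less_irrefl smult_eq_0_iff smult_diff_right eq_iff_diff_eq_0)
qed

lemma is_jacobi_jacobi:
  assumes "\<alpha> > -1" "\<beta> > -1"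
  shows "is_jacobi \<alpha> \<beta> k (jacobi \<alpha> \<beta> k)"
  unfolding jacobi_def by (rule theI'[OF jacobi_ex1[OF assms]])

lemma jacobi_orthonormal:
  assumes "\<alpha> > -1" "\<beta> > -1"
  shows "poly_inner \<alpha> \<beta> (jacobi \<alpha> \<beta> j) (jacobi \<alpha> \<beta> k) = (if j = k then 1 else 0)"
  using is_jacobi_jacobi[OF assms, of j] is_jacobi_jacobi[OF assms, of k]
    poly_inner_commute[of \<alpha> \<beta> "jacobi \<alpha> \<beta> j" "jacobi \<alpha> \<beta> k"]
  by (cases j k rule: linorder_cases) (auto simp: is_jacobi_def)

end

theory Submission
  imports Defs
begin

text \<open>
  Write \<open>T = \<epsilon> powr (-1/r)\<close>. The tensor product Jacobi polynomials form a complete orthonormal system, so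
  \<open>n_eps\<close> of the weighted ball equals the number of multi-indices \<open>k\<close> with \<open>lam a k < T\<close>: the span of
  the corresponding polynomials is admissible, and for every space of smaller dimension some function of
  the ball spanned by these polynomials is orthogonal to it.

  The number \<open>N\<^sub>s(T)\<close> of these indices satisfies \<open>N\<^sub>s\<^sub>+\<^sub>1(T) = (\<Sum>k. N\<^sub>s(T / (a + k)))\<close>, and the volume
  \<open>V\<^sub>s(T)\<close> of the points with coordinates at least \<open>b\<close> and product at most \<open>T\<close> satisfies the same recursion
  with the sum replaced by the integral of \<open>V\<^sub>s(T / x)\<close> over \<open>x \<ge> b\<close>. Since the integrand is decreasing,
  comparing sums with integrals gives \<open>N\<^sub>s \<ge> V\<^sub>s\<close> for \<open>b = a\<close> and \<open>N\<^sub>s \<le> V\<^sub>s\<close> for \<open>b = a - 1\<close>.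
  For \<open>b = a - 1/2\<close> the integrand is even convex, so the sum is a midpoint rule and lies below the
  integral. The gain at the first summand is at least a constant times \<open>T * ln T\<close>, which for large \<open>T\<close>
  outweighs the loss of order \<open>T\<close> from those summands for which the induction hypothesis is not yet
  available. The induction starts at \<open>s = 2\<close>, where Dirichlet's hyperbola method is needed
  because \<open>N\<^sub>1 \<le> V\<^sub>1\<close> fails.
\<close>

section \<open>Approximation numbers of weighted balls\<close>

lemma sum_fun_apply: "(\<Sum>i\<in>I. f i) x = (\<Sum>i\<in>I. f i x :: 'b::comm_monoid_add)"
  by (induction I rule: infinite_finite_induct) auto

text \<open>Only nonnegativity is asked of \<open>ip\<close>, because the elements of
  \<open>L2\<close> are functions and not classes: \<open>ip f f\<close> vanishes for every
  \<open>f\<close> that is zero almost everywhere. The carrier \<open>X\<close> is a subspace of the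
  ambient type, as in \<open>n_eps\<close>.\<close>

locale semi_inner_product_space =
  fixes X :: "'v::real_vector set" and ip :: "'v \<Rightarrow> 'v \<Rightarrow> real"
  assumes subspace_X: "subspace X"
    and ip_add_left: "f \<in> X \<Longrightarrow> g \<in> X \<Longrightarrow> h \<in> X \<Longrightarrow> ip (f + g) h = ip f h + ip g h"
    and ip_scale_left: "f \<in> X \<Longrightarrow> h \<in> X \<Longrightarrow> ip (c *\<^sub>R f) h = c * ip f h"
    and ip_commute: "f \<in> X \<Longrightarrow> g \<in> X \<Longrightarrow> ip f g = ip g f"
    and ip_nonneg: "f \<in> X \<Longrightarrow> ip f f \<ge> 0"
begin

lemma ip_zero_left: "f \<in> X \<Longrightarrow> ip 0 f = 0"
  using ip_scale_left[of f f 0] by simp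

lemma ip_diff_left:
  assumes "f \<in> X" "g \<in> X" "h \<in> X"
  shows "ip (f - g) h = ip f h - ip g h"
  using ip_add_left[of f "(-1) *\<^sub>R g" h] ip_scale_left[of g h "-1"] assms
    subspace_scale[OF subspace_X, of g "-1"] by simp

lemma ip_sum_left:
  assumes "\<And>i. i \<in> I \<Longrightarrow> f i \<in> X" "h \<in> X"
  shows "ip (\<Sum>i\<in>I. c i *\<^sub>R f i) h = (\<Sum>i\<in>I. c i * ip (f i) h)"
  using assms(1)
proof (induction I rule: infinite_finite_induct)
  case (insert i I)
  have "ip (\<Sum>j\<in>insert i I. c j *\<^sub>R f j) h = ip (c i *\<^sub>R f i) h + ip (\<Sum>j\<in>I. c j *\<^sub>R f j) h"
    unfolding sum.insert[OF insert.hyps]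
    by (intro ip_add_left subspace_scale[OF subspace_X] subspace_sum[OF subspace_X] assms(2))
      (auto simp: insert.prems)
  then show ?case using insert by (simp add: ip_scale_left assms(2))
qed (auto simp: ip_zero_left assms(2))

end

locale orthonormal_family = semi_inner_product_space X ip
  for X :: "'v::real_vector set" and ip +
  fixes \<phi> :: "'k \<Rightarrow> 'v"
  assumes \<phi>_in_X: "\<phi> k \<in> X"
    and \<phi>_orthonormal: "ip (\<phi> j) (\<phi> k) = (if j = k then 1 else 0)"
begin

lemma comb_in_X: "(\<Sum>k\<in>J. c k *\<^sub>R \<phi> k) \<in> X"
  by (intro subspace_sum subspace_scale subspace_X \<phi>_in_X)

lemma coeff_comb:
  assumes "finite J"
  shows "ip (\<Sum>k\<in>J. c k *\<^sub>R \<phi> k) (\<phi> l) = (if l \<in> J then c l else 0)"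
proof -
  have "ip (\<Sum>k\<in>J. c k *\<^sub>R \<phi> k) (\<phi> l) = (\<Sum>k\<in>J. c k * (if k = l then 1 else 0))"
    by (subst ip_sum_left) (auto simp: \<phi>_in_X \<phi>_orthonormal)
  also have "\<dots> = (\<Sum>k\<in>J. if k = l then c k else 0)" by (intro sum.cong) auto
  also have "\<dots> = (if l \<in> J then c l else 0)" using assms by (subst sum.delta) auto
  finally show ?thesis .
qed

lemma ip_self_comb:
  assumes "finite J"
  shows "ip (\<Sum>k\<in>J. c k *\<^sub>R \<phi> k) (\<Sum>k\<in>J. c k *\<^sub>R \<phi> k) = (\<Sum>k\<in>J. (c k)\<^sup>2)"
  by (subst ip_sum_left)
    (auto simp: \<phi>_in_X comb_in_X ip_commute[OF \<phi>_in_X comb_in_X] coeff_comb[OF assms]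
      power2_eq_square intro!: sum.cong)

text \<open>Completing the square in the coefficients. The last sum vanishes exactly for the Fourier
  coefficients; it is dropped to bound the error of an arbitrary combination from below, and it is
  zero for the Fourier partial sum.\<close>

lemma ip_self_diff_comb:
  assumes J: "finite J" and f: "f \<in> X"
  shows "ip (f - (\<Sum>k\<in>J. c k *\<^sub>R \<phi> k)) (f - (\<Sum>k\<in>J. c k *\<^sub>R \<phi> k))
    = ip f f - (\<Sum>k\<in>J. (ip f (\<phi> k))\<^sup>2) + (\<Sum>k\<in>J. (c k - ip f (\<phi> k))\<^sup>2)"
proof -
  let ?g = "\<Sum>k\<in>J. c k *\<^sub>R \<phi> k"
  have g: "?g \<in> X" and fg: "f - ?g \<in> X"
    by (auto intro: comb_in_X subspace_diff[OF subspace_X] f)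
  have "ip (f - ?g) (f - ?g) = ip f f - ip ?g f - (ip f ?g - ip ?g ?g)"
    using ip_diff_left[OF f g fg] ip_commute[OF f fg] ip_commute[OF g fg]
      ip_diff_left[OF f g f] ip_diff_left[OF f g g] by simp
  also have "ip f ?g = ip ?g f" using ip_commute f g by blast
  also have "ip ?g f = (\<Sum>k\<in>J. c k * ip f (\<phi> k))"
    using f by (subst ip_sum_left) (auto simp: \<phi>_in_X ip_commute[OF \<phi>_in_X f])
  also have "ip ?g ?g = (\<Sum>k\<in>J. (c k)\<^sup>2)" by (rule ip_self_comb[OF J])
  finally show ?thesis
    by (simp add: power2_diff sum.distrib sum_subtractf sum_distrib_left algebra_simps)
qed

lemma span_range_explicit:
  assumes "g \<in> span (range \<phi>)"
  obtains J c where "finite J" "g = (\<Sum>k\<in>J. c k *\<^sub>R \<phi> k)"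
proof -
  have "\<exists>J c. finite J \<and> g = (\<Sum>k\<in>J. c k *\<^sub>R \<phi> k)"
    using assms
  proof (induction rule: span_induct_alt)
    case base
    show ?case by (intro exI[of _ "{}"]) simp
  next
    case (step d v y)
    then obtain J c k where J: "finite J" "y = (\<Sum>k\<in>J. c k *\<^sub>R \<phi> k)" and k: "v = \<phi> k" by auto
    \<comment> \<open>The index \<open>k\<close> may or may not lie in \<open>J\<close>;
      \<open>c'\<close> adds \<open>d\<close> to its coefficient in either case.\<close>
    define c' where "c' = (\<lambda>j. (if j \<in> J then c j else 0) + (if j = k then d else 0))"
    have "(\<Sum>j\<in>insert k J. c' j *\<^sub>R \<phi> j) = (\<Sum>j\<in>insert k J. (if j \<in> J then c j *\<^sub>R \<phi> j else 0))
       + (\<Sum>j\<in>insert k J. (if j = k then d *\<^sub>R \<phi> j else 0))"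
      by (subst sum.distrib[symmetric], rule sum.cong) (auto simp: c'_def scaleR_add_left)
    also have "(\<Sum>j\<in>insert k J. (if j \<in> J then c j *\<^sub>R \<phi> j else 0)) = y"
      unfolding J(2) using J(1) by (intro sum.mono_neutral_cong_right) auto
    also have "(\<Sum>j\<in>insert k J. (if j = k then d *\<^sub>R \<phi> j else 0)) = d *\<^sub>R \<phi> k"
      using J(1) by (subst sum.delta) auto
    finally show ?case using J(1) k by (intro exI[of _ "insert k J"] exI[of _ c']) (simp add: add.commute)
  qed
  then show ?thesis using that by blast
qed

text \<open>An underdetermined homogeneous linear system has a nontrivial solution.\<close>
lemma exists_orthogonal_comb:
  assumes B: "finite B" "B \<subseteq> X" and J: "finite J" "card B < card J"
  obtains c where "(\<Sum>k\<in>J. (c k)\<^sup>2) = 1"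
    "\<forall>g\<in>span B. ip (\<Sum>k\<in>J. c k *\<^sub>R \<phi> k) g = 0"
proof -
  \<comment> \<open>The conditions on the coefficients become a linear relation among the vectors
    \<open>v k\<close>. They are functions supported on \<open>B\<close>, hence lie in the span of
    the at most \<open>card B\<close> unit functions \<open>e b\<close>.\<close>
  define v where "v = (\<lambda>k b. if b \<in> B then ip (\<phi> k) b else 0)"
  define e :: "'v \<Rightarrow> 'v \<Rightarrow> real" where "e = (\<lambda>b b'. if b' = b then 1 else 0)"
  have v_span: "v k \<in> span (e ` B)" for k
  proof -
    have "v k = (\<Sum>b\<in>B. v k b *\<^sub>R e b)"
    proof
      fix x
      have "(\<Sum>b\<in>B. v k b *\<^sub>R e b) x = (\<Sum>b\<in>B. if b = x then v k b else 0)"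
        unfolding sum_fun_apply by (intro sum.cong) (auto simp: scaleR_fun_def e_def)
      then show "v k x = (\<Sum>b\<in>B. v k b *\<^sub>R e b) x"
        using B(1) by (simp add: v_def)
    qed
    also have "\<dots> \<in> span (e ` B)"
      by (intro span_sum span_scale span_base) auto
    finally show ?thesis .
  qed
  have "\<exists>c. (\<exists>k\<in>J. c k \<noteq> 0) \<and> (\<Sum>k\<in>J. c k *\<^sub>R v k) = 0"
  \<comment> \<open>Dependence is a notion for sets. If \<open>v\<close> repeats a value, the image
    may be smaller than \<open>J\<close>, and the relation is read off from the repetition
    instead.\<close>
  proof (cases "inj_on v J")
    case False
    then obtain i j where ij: "i \<in> J" "j \<in> J" "i \<noteq> j" "v i = v j" by (auto simp: inj_on_def)
    define c where "c = (\<lambda>k. if k = i then 1 else if k = j then -1 else 0 :: real)"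
    have "(\<Sum>k\<in>J. c k *\<^sub>R v k) = (\<Sum>k\<in>{i,j}. c k *\<^sub>R v k)"
      using ij J(1) by (intro sum.mono_neutral_right) (auto simp: c_def)
    then show ?thesis using ij by (intro exI[of _ c]) (auto simp: c_def)
  next
    case True
    have "dependent (v ` J)"
    proof (rule ccontr)
      assume "\<not> ?thesis"
      then have "card (v ` J) \<le> card (e ` B)"
        using independent_span_bound[of "e ` B" "v ` J"] v_span B(1) by auto
      also have "\<dots> \<le> card B" using B(1) by (rule card_image_le)
      finally show False using J(2) card_image[OF True] by simp
    qed
    then obtain u where u: "\<exists>w\<in>v ` J. u w \<noteq> 0" "(\<Sum>w\<in>v ` J. u w *\<^sub>R w) = 0"
      using dependent_finite[of "v ` J"] J(1) by auto
    then show ?thesis using True by (intro exI[of _ "u \<circ> v"]) (auto simp: sum.reindex)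
  qed
  then obtain c where c: "\<exists>k\<in>J. c k \<noteq> 0" "(\<Sum>k\<in>J. c k *\<^sub>R v k) = 0" by auto
  define S where "S = (\<Sum>k\<in>J. (c k)\<^sup>2)"
  have "S > 0" unfolding S_def using c(1) J(1) by (auto intro: sum_pos2)
  define d where "d = (\<lambda>k. c k / sqrt S)"
  let ?f = "\<Sum>k\<in>J. d k *\<^sub>R \<phi> k"
  have "(\<Sum>k\<in>J. (d k)\<^sup>2) = 1"
    using \<open>S > 0\<close> by (simp add: d_def power_divide S_def flip: sum_divide_distrib)
  moreover have *: "ip ?f b = 0" if "b \<in> B" for b
  proof -
    have "ip ?f b = (\<Sum>k\<in>J. d k * ip (\<phi> k) b)"
      using that B by (subst ip_sum_left) (auto simp: \<phi>_in_X)
    also have "\<dots> = (\<Sum>k\<in>J. c k *\<^sub>R v k) b / sqrt S"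
      using that by (simp add: d_def v_def sum_fun_apply scaleR_fun_def sum_divide_distrib)
    finally show ?thesis by (simp add: c(2))
  qed
  have "ip ?f g = 0 \<and> g \<in> X" if "g \<in> span B" for g
    using that
  proof (induction rule: span_induct_alt)
    case base
    show ?case using ip_zero_left[OF comb_in_X] ip_commute[OF comb_in_X subspace_0[OF subspace_X]]
      subspace_0[OF subspace_X] by simp
  next
    case (step t x y)
    then have x: "x \<in> X" "t *\<^sub>R x \<in> X" using B subspace_scale[OF subspace_X] by auto
    then have "t *\<^sub>R x + y \<in> X" using step subspace_add[OF subspace_X] by auto
    moreover have "ip (t *\<^sub>R x + y) ?f = t * ip x ?f + ip y ?f"
      using x step by (simp add: comb_in_X ip_add_left ip_scale_left)
    moreover have "ip x ?f = 0" using *[of x] step ip_commute[OF comb_in_X x(1)] by simp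
    moreover have "ip y ?f = 0" using step ip_commute[OF comb_in_X, of y] by simp
    ultimately show ?case using ip_commute[OF comb_in_X, of "t *\<^sub>R x + y"] by simp
  qed
  ultimately show ?thesis using that by blast
qed

text \<open>Outside the index set all weights are at least \<open>T\<close>, which yields error at
  most \<open>T powr (-r)\<close> for the Fourier partial sum. On the finite index set the largest
  weight is strictly below \<open>T\<close>, which yields an error strictly above
  \<open>T powr (-r)\<close> for every space of too small dimension. Hence equality for every
  \<open>T\<close>, also at its jumps.\<close>

theorem n_eps_weighted_ball:
  fixes \<mu> :: "'k \<Rightarrow> real" and r T :: real
  defines "W \<equiv> {f \<in> X. (\<lambda>k. \<mu> k powr (2 * r) * \<bar>ip f (\<phi> k)\<bar>\<^sup>2) summable_on UNIV \<and>
      sqrt (\<Sum>\<^sub>\<infinity>k. \<mu> k powr (2 * r) * \<bar>ip f (\<phi> k)\<bar>\<^sup>2) \<le> 1}"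
  assumes dense: "\<And>f \<delta>. f \<in> X \<Longrightarrow> \<delta> > 0 \<Longrightarrow> \<exists>g\<in>span (range \<phi>). ip (f - g) (f - g) < \<delta>"
    and \<mu>: "\<And>k. \<mu> k > 0" and fin: "finite {k. \<mu> k < T}" and r: "r > 0" and T: "T > 0"
  shows "n_eps (\<lambda>f. sqrt (ip f f)) W X (T powr (-r)) = enat (card {k. \<mu> k < T})"
proof -
  define \<Lambda> where "\<Lambda> = {k. \<mu> k < T}"
  define \<epsilon> where "\<epsilon> = T powr (-r)"
  have \<epsilon>: "\<epsilon> > 0" "\<epsilon>\<^sup>2 = T powr (-(2 * r))"
    using T by (auto simp: \<epsilon>_def power2_eq_square simp flip: powr_add)
  have fin\<Lambda>: "finite \<Lambda>" using fin by (simp add: \<Lambda>_def)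
  have upper: "\<exists>L. subspace L \<and> L \<subseteq> X \<and> (\<exists>B. finite B \<and> span B = L) \<and> dim L \<le> card \<Lambda> \<and>
      (SUP f\<in>W. INF g\<in>L. ereal (sqrt (ip (f - g) (f - g)))) \<le> ereal \<epsilon>"
  proof (rule exI[of _ "span (\<phi> ` \<Lambda>)"], intro conjI)
    show "span (\<phi> ` \<Lambda>) \<subseteq> X" using subspace_X \<phi>_in_X by (intro span_minimal) auto
    show "dim (span (\<phi> ` \<Lambda>)) \<le> card \<Lambda>"
      using dim_le_card'[of "\<phi> ` \<Lambda>"] card_image_le[OF fin\<Lambda>, of \<phi>] fin\<Lambda> by (simp add: dim_span)
    show "(SUP f\<in>W. INF g\<in>span (\<phi> ` \<Lambda>). ereal (sqrt (ip (f - g) (f - g)))) \<le> ereal \<epsilon>"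
    proof (rule SUP_least)
      fix f assume "f \<in> W"
      then have f: "f \<in> X" and sm: "(\<lambda>k. \<mu> k powr (2 * r) * \<bar>ip f (\<phi> k)\<bar>\<^sup>2) summable_on UNIV"
        and le1: "(\<Sum>\<^sub>\<infinity>k. \<mu> k powr (2 * r) * \<bar>ip f (\<phi> k)\<bar>\<^sup>2) \<le> 1"
        by (auto simp: W_def)
      let ?g = "\<Sum>k\<in>\<Lambda>. ip f (\<phi> k) *\<^sub>R \<phi> k"
      have tail: "(\<Sum>k\<in>J - \<Lambda>. (ip f (\<phi> k))\<^sup>2) \<le> \<epsilon>\<^sup>2" if J: "finite J" for J
      proof -
        have "(\<Sum>k\<in>J - \<Lambda>. (ip f (\<phi> k))\<^sup>2) \<le> (\<Sum>k\<in>J - \<Lambda>. \<epsilon>\<^sup>2 * (\<mu> k powr (2 * r) * \<bar>ip f (\<phi> k)\<bar>\<^sup>2))"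
        proof (rule sum_mono)
          fix k assume "k \<in> J - \<Lambda>"
          then have "T powr (2 * r) \<le> \<mu> k powr (2 * r)"
            using T r by (intro powr_mono2) (auto simp: \<Lambda>_def)
          then have "1 \<le> \<epsilon>\<^sup>2 * \<mu> k powr (2 * r)"
            using T by (simp add: \<epsilon> powr_minus field_simps)
          then have "(ip f (\<phi> k))\<^sup>2 * 1 \<le> (ip f (\<phi> k))\<^sup>2 * (\<epsilon>\<^sup>2 * \<mu> k powr (2 * r))"
            by (intro mult_left_mono) auto
          then show "(ip f (\<phi> k))\<^sup>2 \<le> \<epsilon>\<^sup>2 * (\<mu> k powr (2 * r) * \<bar>ip f (\<phi> k)\<bar>\<^sup>2)"
            by (simp add: algebra_simps)
        qed
        also have "\<dots> = \<epsilon>\<^sup>2 * (\<Sum>k\<in>J - \<Lambda>. \<mu> k powr (2 * r) * \<bar>ip f (\<phi> k)\<bar>\<^sup>2)"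
          by (simp add: sum_distrib_left)
        also have "\<dots> \<le> \<epsilon>\<^sup>2 * (\<Sum>\<^sub>\<infinity>k. \<mu> k powr (2 * r) * \<bar>ip f (\<phi> k)\<bar>\<^sup>2)"
          using J by (intro mult_left_mono finite_sum_le_infsum sm) auto
        also have "\<dots> \<le> \<epsilon>\<^sup>2 * 1" using le1 by (intro mult_left_mono) auto
        finally show ?thesis by simp
      qed
      \<comment> \<open>Bessel's inequality does not bound \<open>ip f f\<close> from above. Density
        does: up to \<open>\<delta>\<close> the value \<open>ip f f\<close> is a finite sum of
        squared coefficients, whose part outside \<open>\<Lambda>\<close> is bounded by
        \<open>tail\<close>.\<close>
      have "ip (f - ?g) (f - ?g) \<le> \<epsilon>\<^sup>2 + \<delta>" if \<delta>: "\<delta> > 0" for \<delta>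
      proof -
        obtain h where h: "h \<in> span (range \<phi>)" "ip (f - h) (f - h) < \<delta>" using dense[OF f \<delta>] by auto
        from h(1) obtain J c where J: "finite J" "h = (\<Sum>k\<in>J. c k *\<^sub>R \<phi> k)"
          by (rule span_range_explicit)
        have "ip f f - (\<Sum>k\<in>J. (ip f (\<phi> k))\<^sup>2) \<le> ip (f - h) (f - h)"
          unfolding J(2) ip_self_diff_comb[OF J(1) f] by (simp add: sum_nonneg)
        moreover have "(\<Sum>k\<in>J. (ip f (\<phi> k))\<^sup>2) \<le> (\<Sum>k\<in>\<Lambda>. (ip f (\<phi> k))\<^sup>2) + (\<Sum>k\<in>J - \<Lambda>. (ip f (\<phi> k))\<^sup>2)"
          using J(1) fin\<Lambda> by (subst sum.union_disjoint[symmetric]) (auto intro!: sum_mono2)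
        ultimately show ?thesis
          using h(2) tail[OF J(1)] unfolding ip_self_diff_comb[OF fin\<Lambda> f] by simp
      qed
      then have "ip (f - ?g) (f - ?g) \<le> \<epsilon>\<^sup>2" by (rule field_le_epsilon)
      then have "sqrt (ip (f - ?g) (f - ?g)) \<le> \<epsilon>" using \<epsilon>(1) by (intro real_le_lsqrt) auto
      moreover have "?g \<in> span (\<phi> ` \<Lambda>)" by (intro span_sum span_scale span_base) auto
      ultimately show "(INF g\<in>span (\<phi> ` \<Lambda>). ereal (sqrt (ip (f - g) (f - g)))) \<le> ereal \<epsilon>"
        by (intro INF_lower2) auto
    qed
    show "\<exists>B. finite B \<and> span B = span (\<phi> ` \<Lambda>)"
      using fin\<Lambda> by (intro exI[of _ "\<phi> ` \<Lambda>"]) simp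
  qed simp
  have lower: "card \<Lambda> \<le> n"
    if L: "subspace L" "L \<subseteq> X" "finite B" "span B = L" "dim L \<le> n"
      and SUP: "(SUP f\<in>W. INF g\<in>L. ereal (sqrt (ip (f - g) (f - g)))) \<le> ereal \<epsilon>" for n L B
  proof (rule ccontr)
    assume "\<not> card \<Lambda> \<le> n"
    \<comment> \<open>The orthogonality argument counts spanning vectors, so the spanning set is
      thinned to a basis, whose cardinality is \<open>dim L\<close>.\<close>
    obtain B' where B'': "B' \<subseteq> B" "independent B'" "B \<subseteq> span B'"
      using maximal_independent_subset[of B] by blast
    then have B': "B' \<subseteq> B" "independent B'" "span B' = span B"
      using span_mono[OF B''(1)] span_minimal[OF B''(3) subspace_span] by auto
    have finB': "finite B'" using B'(1) L(3) finite_subset by auto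
    have "card B' = dim L"
      using dim_span_eq_card_independent[OF B'(2)] B'(3) L(4) by simp
    then have cB: "card B' < card \<Lambda>" using L(5) \<open>\<not> card \<Lambda> \<le> n\<close> by simp
    have BX: "B' \<subseteq> X" using B'(3) L(2,4) span_superset by blast
    obtain c where c: "(\<Sum>k\<in>\<Lambda>. (c k)\<^sup>2) = 1"
      "\<forall>g\<in>span B'. ip (\<Sum>k\<in>\<Lambda>. c k *\<^sub>R \<phi> k) g = 0"
      by (rule exists_orthogonal_comb[OF finB' BX fin\<Lambda> cB])
    have "\<Lambda> \<noteq> {}" using c(1) by auto
    define M where "M = Max (\<mu> ` \<Lambda>)"
    have M: "\<mu> k \<le> M" if "k \<in> \<Lambda>" for k using that fin\<Lambda> by (auto simp: M_def)
    have "M \<in> \<mu> ` \<Lambda>" unfolding M_def using fin\<Lambda> \<open>\<Lambda> \<noteq> {}\<close> by (intro Max_in) auto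
    then have Mpos: "M > 0" "M < T" using \<mu> by (auto simp: \<Lambda>_def)
    \<comment> \<open>Since every weight on \<open>\<Lambda>\<close> is at most \<open>M\<close>, a
      combination with coefficient norm \<open>M powr (-r)\<close> lies in the ball. Being
      orthogonal to \<open>L\<close>, it has distance at least \<open>M powr (-r)\<close> from
      \<open>L\<close>.\<close>
    define d where "d = (\<lambda>k. M powr (-r) * c k)"
    define f where "f = (\<Sum>k\<in>\<Lambda>. d k *\<^sub>R \<phi> k)"
    have f_alt: "f = M powr (-r) *\<^sub>R (\<Sum>k\<in>\<Lambda>. c k *\<^sub>R \<phi> k)"
      by (simp add: f_def d_def scaleR_sum_right)
    have fX: "f \<in> X" unfolding f_def by (rule comb_in_X)
    have coeff: "ip f (\<phi> k) = (if k \<in> \<Lambda> then d k else 0)" for k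
      unfolding f_def by (rule coeff_comb[OF fin\<Lambda>])
    let ?t = "\<lambda>k. \<mu> k powr (2 * r) * \<bar>ip f (\<phi> k)\<bar>\<^sup>2"
    have hs: "(?t has_sum (\<Sum>k\<in>\<Lambda>. ?t k)) UNIV"
      using has_sum_finite[OF fin\<Lambda>, of ?t]
      by (rule has_sum_cong_neutral[THEN iffD1, rotated -1]) (auto simp: coeff)
    have M2: "M powr (2 * r) * (M powr (-r))\<^sup>2 = 1"
      using Mpos by (simp add: power2_eq_square flip: powr_add)
    have "(\<Sum>k\<in>\<Lambda>. ?t k) \<le> (\<Sum>k\<in>\<Lambda>. M powr (2 * r) * (M powr (-r))\<^sup>2 * (c k)\<^sup>2)"
    proof (rule sum_mono)
      fix k assume k: "k \<in> \<Lambda>"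
      have "\<mu> k powr (2 * r) \<le> M powr (2 * r)"
        using M[OF k] \<mu>[of k] r by (intro powr_mono2) auto
      then have "\<mu> k powr (2 * r) * (d k)\<^sup>2 \<le> M powr (2 * r) * (d k)\<^sup>2" by (rule mult_right_mono) simp
      then show "?t k \<le> M powr (2 * r) * (M powr (-r))\<^sup>2 * (c k)\<^sup>2"
        using k by (simp add: coeff d_def power_mult_distrib mult.assoc)
    qed
    also have "\<dots> = 1" using c(1) by (simp add: M2)
    finally have "f \<in> W"
      using hs fX infsumI[OF hs] by (auto simp: W_def summable_on_def)
    have "ip f f = (\<Sum>k\<in>\<Lambda>. (d k)\<^sup>2)" unfolding f_def by (rule ip_self_comb[OF fin\<Lambda>])
    also have "\<dots> = (M powr (-r))\<^sup>2" using c(1) by (simp add: d_def power_mult_distrib flip: sum_distrib_left)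
    finally have ff: "ip f f = (M powr (-r))\<^sup>2" .
    have "ereal (M powr (-r)) \<le> (INF g\<in>L. ereal (sqrt (ip (f - g) (f - g))))"
    proof (rule INF_greatest)
      fix g assume g: "g \<in> L"
      then have gX: "g \<in> X" and "f - g \<in> X" using L(2) subspace_diff[OF subspace_X] fX by auto
      have "ip f g = 0"
        unfolding f_alt using c(2) g B'(3) L(4) gX by (subst ip_scale_left) (auto intro: comb_in_X)
      then have "ip (f - g) (f - g) = ip f f + ip g g"
        using ip_diff_left[OF fX gX \<open>f - g \<in> X\<close>] ip_commute[OF fX \<open>f - g \<in> X\<close>] ip_commute[OF gX \<open>f - g \<in> X\<close>]
          ip_diff_left[OF fX gX fX] ip_diff_left[OF fX gX gX] ip_commute[OF fX gX] by simp
      then have "(M powr (-r))\<^sup>2 \<le> ip (f - g) (f - g)" using ff ip_nonneg[OF gX] by simp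
      then show "ereal (M powr (-r)) \<le> ereal (sqrt (ip (f - g) (f - g)))"
        by (simp add: real_le_rsqrt)
    qed
    also have "\<dots> \<le> (SUP f\<in>W. INF g\<in>L. ereal (sqrt (ip (f - g) (f - g))))"
      using \<open>f \<in> W\<close> by (rule SUP_upper)
    also have "\<dots> \<le> ereal \<epsilon>" by (rule SUP)
    finally have "M powr (-r) \<le> T powr (-r)" by (simp add: \<epsilon>_def)
    moreover have "T powr (-r) < M powr (-r)"
      using Mpos r by (intro powr_less_mono2_neg) auto
    ultimately show False by simp
  qed
  show ?thesis
    unfolding n_eps_def \<epsilon>_def[symmetric] \<Lambda>_def[symmetric]
  proof (rule antisym)
    show "Inf {enat n |n. \<exists>L. subspace L \<and> L \<subseteq> X \<and> (\<exists>B. finite B \<and> span B = L) \<and> dim L \<le> n \<and>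
        (SUP f\<in>W. INF g\<in>L. ereal (sqrt (ip (f - g) (f - g)))) \<le> ereal \<epsilon>} \<le> enat (card \<Lambda>)"
      using upper by (intro Inf_lower) auto
    show "enat (card \<Lambda>) \<le> Inf {enat n |n. \<exists>L. subspace L \<and> L \<subseteq> X \<and> (\<exists>B. finite B \<and> span B = L) \<and> dim L \<le> n \<and>
        (SUP f\<in>W. INF g\<in>L. ereal (sqrt (ip (f - g) (f - g)))) \<le> ereal \<epsilon>}"
    proof (rule Inf_greatest)
      fix m assume "m \<in> {enat n |n. \<exists>L. subspace L \<and> L \<subseteq> X \<and> (\<exists>B. finite B \<and> span B = L) \<and> dim L \<le> n \<and>
        (SUP f\<in>W. INF g\<in>L. ereal (sqrt (ip (f - g) (f - g)))) \<le> ereal \<epsilon>}"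
      then obtain n L B where "m = enat n" "subspace L" "L \<subseteq> X" "finite B" "span B = L" "dim L \<le> n"
          "(SUP f\<in>W. INF g\<in>L. ereal (sqrt (ip (f - g) (f - g)))) \<le> ereal \<epsilon>" by blast
      then show "enat (card \<Lambda>) \<le> m" using lower[of L B n] by simp
    qed
  qed
qed

end

section \<open>The weighted space on the cube\<close>

lemma borel_measurable_poly [measurable]: "poly (p :: real poly) \<in> borel_measurable borel"
  by (intro borel_measurable_continuous_onI continuous_intros)

lemma borel_measurable_component [measurable]: "(\<lambda>x :: real ^ 's. x $ j) \<in> borel_measurable borel"
  by (intro borel_measurable_continuous_onI continuous_intros)

text \<open>Fubini for \<open>real ^ 's\<close>: its Lebesgue measure is the image of a product
  measure indexed by \<open>Basis\<close>. The translation between \<open>Basis\<close> and the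
  index type is done by \<open>axis\<close> and \<open>axis_index\<close>.\<close>

lemma
  fixes g :: "'s::finite \<Rightarrow> real \<Rightarrow> real"
  assumes g: "\<And>j. integrable lborel (g j)"
  shows integrable_prod_component: "integrable lborel (\<lambda>x :: real ^ 's. \<Prod>j\<in>UNIV. g j (x $ j))"
    and integral_prod_component:
      "(\<integral>x. (\<Prod>j\<in>UNIV. g j (x $ j)) \<partial>(lborel :: (real ^ 's) measure)) = (\<Prod>j\<in>UNIV. \<integral>t. g j t \<partial>lborel)"
proof -
  interpret product_sigma_finite "\<lambda>_ :: real ^ 's. lborel :: real measure" ..
  define h where "h = (\<lambda>b :: real ^ 's. g (axis_index b))"
  have [measurable]: "g j \<in> borel_measurable borel" for j
    using borel_measurable_integrable[OF g[of j]] by simp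
  have idx: "axis_index (axis j 1 :: real ^ 's) = j" for j
    using axis_index[of "axis j 1 :: real ^ 's"] by (auto simp: axis_eq_axis Basis_vec_def)
  have Basis: "(Basis :: (real ^ 's) set) = (\<lambda>j. axis j 1) ` UNIV" by (auto simp: Basis_vec_def)
  have inj: "inj (\<lambda>j :: 's. axis j 1 :: real ^ 's)" by (auto simp: inj_on_def axis_eq_axis)
  have reindex: "(\<Prod>b\<in>(Basis :: (real ^ 's) set). F b) = (\<Prod>j\<in>UNIV. F (axis j 1))" for F :: "_ \<Rightarrow> real"
    unfolding Basis by (subst prod.reindex[OF inj]) simp
  have comp: "(\<Sum>b\<in>Basis. f b *\<^sub>R b :: real ^ 's) $ j = f (axis j 1)" for f j
  proof -
    have "(\<Sum>b\<in>Basis. f b *\<^sub>R b :: real ^ 's) $ j = (\<Sum>b\<in>Basis. f b *\<^sub>R b) \<bullet> axis j 1"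
      by (simp add: inner_axis)
    also have "\<dots> = f (axis j 1)" by (subst inner_sum_left_Basis) auto
    finally show ?thesis .
  qed
  have meas: "(\<lambda>f. \<Sum>b\<in>Basis. f b *\<^sub>R b :: real ^ 's) \<in> measurable (Pi\<^sub>M Basis (\<lambda>_. lborel)) borel"
    by measurable
  have prod_h: "(\<Prod>j\<in>UNIV. g j ((\<Sum>b\<in>Basis. f b *\<^sub>R b :: real ^ 's) $ j)) = (\<Prod>b\<in>Basis. h b (f b))" for f
    unfolding reindex comp h_def idx ..
  have h: "integrable lborel (h b)" for b by (simp add: h_def g)
  have m: "(\<lambda>x :: real ^ 's. \<Prod>j\<in>UNIV. g j (x $ j)) \<in> borel_measurable borel" by measurable
  show "integrable lborel (\<lambda>x :: real ^ 's. \<Prod>j\<in>UNIV. g j (x $ j))"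
    unfolding lborel_eq[where 'a = "real ^ 's"] integrable_distr_eq[OF meas m] prod_h
    by (intro product_integrable_prod h) simp
  have "(\<integral>x. (\<Prod>j\<in>UNIV. g j (x $ j)) \<partial>(lborel :: (real ^ 's) measure))
      = (\<integral>f. (\<Prod>b\<in>Basis. h b (f b)) \<partial>(Pi\<^sub>M (Basis :: (real ^ 's) set) (\<lambda>_. lborel)))"
    unfolding lborel_eq[where 'a = "real ^ 's"] integral_distr[OF meas m] prod_h ..
  also have "\<dots> = (\<Prod>b\<in>Basis. \<integral>t. h b t \<partial>lborel)"
    by (intro product_integral_prod h) simp
  also have "\<dots> = (\<Prod>j\<in>UNIV. \<integral>t. g j t \<partial>lborel)"
    unfolding reindex h_def idx ..
  finally show "(\<integral>x. (\<Prod>j\<in>UNIV. g j (x $ j)) \<partial>(lborel :: (real ^ 's) measure)) = (\<Prod>j\<in>UNIV. \<integral>t. g j t \<partial>lborel)" .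
qed

lemma unit_cube_eq_cbox: "(unit_cube :: (real ^ 's) set) = cbox (\<chi> j. -1) (\<chi> j. 1)"
  by (auto simp: unit_cube_def mem_box_cart)

lemma compact_unit_cube: "compact (unit_cube :: (real ^ 's) set)"
  by (simp add: unit_cube_eq_cbox)

lemma unit_cube_borel [measurable]: "(unit_cube :: (real ^ 's) set) \<in> sets borel"
  by (simp add: unit_cube_eq_cbox)

lemma space_weight_measure [simp]: "space (weight_measure \<alpha> \<beta> :: (real ^ 's) measure) = unit_cube"
  by (simp add: weight_measure_def space_restrict_space)

lemma sets_weight_measure:
  "sets (weight_measure \<alpha> \<beta> :: (real ^ 's::finite) measure) = sets (restrict_space borel unit_cube)"
  by (simp add: weight_measure_def sets_restrict_space)

lemma borel_measurable_weight_measure_iff: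
  fixes f :: "real ^ 's \<Rightarrow> real"
  shows "f \<in> borel_measurable (weight_measure \<alpha> \<beta>) \<longleftrightarrow> (\<lambda>x. indicator unit_cube x * f x) \<in> borel_measurable borel"
proof -
  have "f \<in> borel_measurable (weight_measure \<alpha> \<beta>) \<longleftrightarrow> f \<in> borel_measurable (restrict_space borel unit_cube)"
    by (simp only: measurable_cong_sets[OF sets_weight_measure refl])
  also have "\<dots> \<longleftrightarrow> (\<lambda>x. indicator unit_cube x *\<^sub>R f x) \<in> borel_measurable borel"
    by (rule borel_measurable_restrict_space_iff) measurable
  finally show ?thesis by simp
qed

lemma borel_measurable_weight_measure:
  fixes f :: "real ^ 's \<Rightarrow> real"
  assumes [measurable]: "f \<in> borel_measurable borel"
  shows "f \<in> borel_measurable (weight_measure \<alpha> \<beta>)"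
  unfolding borel_measurable_weight_measure_iff by measurable

lemma AE_weight_measure:
  fixes P :: "real ^ 's \<Rightarrow> bool"
  assumes "AE x in lborel. x \<in> unit_cube \<longrightarrow> P x"
  shows "AE x in weight_measure \<alpha> \<beta>. P x"
proof -
  have 1: "(\<lambda>x :: real ^ 's. ennreal (\<Prod>j\<in>UNIV. jacobi_weight \<alpha> \<beta> (x $ j)))
      \<in> borel_measurable (restrict_space lborel unit_cube)"
    by (intro measurable_restrict_space1) measurable
  have "AE x in restrict_space lborel unit_cube. P x"
    using assms by (subst AE_restrict_space_iff) auto
  then show ?thesis
    unfolding weight_measure_def AE_density[OF 1] by eventually_elim simp
qed

text \<open>Once the density and the restriction to the cube are moved into the integrand, it
  factorizes, because the indicator of the cube is the product of the indicators of the
  intervals.\<close>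

lemma
  fixes f :: "'s::finite \<Rightarrow> real \<Rightarrow> real"
  assumes f: "\<And>j. set_integrable lborel {-1..1} (\<lambda>t. f j t * jacobi_weight \<alpha> \<beta> t)"
    and [measurable]: "\<And>j. f j \<in> borel_measurable borel"
  shows integrable_weight_measure_prod:
      "integrable (weight_measure \<alpha> \<beta>) (\<lambda>x :: real ^ 's. \<Prod>j\<in>UNIV. f j (x $ j))"
    and integral_weight_measure_prod:
      "(\<integral>x. (\<Prod>j\<in>UNIV. f j (x $ j)) \<partial>(weight_measure \<alpha> \<beta> :: (real ^ 's) measure))
        = (\<Prod>j\<in>UNIV. LINT t:{-1..1}|lborel. f j t * jacobi_weight \<alpha> \<beta> t)"
proof -
  define g where "g = (\<lambda>j t. indicator {-1..1} t * (f j t * jacobi_weight \<alpha> \<beta> t))"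
  have g: "integrable lborel (g j)" for j
    using f[of j] by (simp add: set_integrable_def g_def)
  have prod_g: "indicator unit_cube x *\<^sub>R ((\<Prod>j\<in>UNIV. jacobi_weight \<alpha> \<beta> (x $ j)) *\<^sub>R (\<Prod>j\<in>UNIV. f j (x $ j)))
      = (\<Prod>j\<in>UNIV. g j (x $ j))" for x :: "real ^ 's"
  proof -
    have "indicat_real unit_cube x = (\<Prod>j\<in>UNIV. indicator {-1..1} (x $ j))"
    proof (cases "x \<in> unit_cube")
      case False
      then obtain j where "x $ j \<notin> {-1..1}" by (auto simp: unit_cube_def)
      then have "\<exists>j\<in>UNIV. indicat_real {-1..1} (x $ j) = 0" by (intro bexI[of _ j]) simp_all
      then show ?thesis using False prod_zero[OF finite, of UNIV] by simp
    qed (simp add: unit_cube_def)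
    then show ?thesis by (simp add: g_def mult_ac flip: prod.distrib)
  qed
  have m: "(\<lambda>x :: real ^ 's. \<Prod>j\<in>UNIV. f j (x $ j)) \<in> borel_measurable (restrict_space lborel unit_cube)"
      "(\<lambda>x :: real ^ 's. \<Prod>j\<in>UNIV. jacobi_weight \<alpha> \<beta> (x $ j)) \<in> borel_measurable (restrict_space lborel unit_cube)"
    by (intro measurable_restrict_space1; measurable)+
  have nn: "AE x in restrict_space lborel unit_cube. 0 \<le> (\<Prod>j\<in>UNIV. jacobi_weight \<alpha> \<beta> ((x :: real ^ 's) $ j))"
    by (simp add: prod_nonneg jacobi_weight_nonneg)
  have \<Omega>: "unit_cube \<inter> space lborel \<in> sets (lborel :: (real ^ 's) measure)" by simp
  show "integrable (weight_measure \<alpha> \<beta>) (\<lambda>x :: real ^ 's. \<Prod>j\<in>UNIV. f j (x $ j))"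
    unfolding weight_measure_def integrable_density[OF m nn] integrable_restrict_space[OF \<Omega>] prod_g
    by (rule integrable_prod_component[OF g])
  show "(\<integral>x. (\<Prod>j\<in>UNIV. f j (x $ j)) \<partial>(weight_measure \<alpha> \<beta> :: (real ^ 's) measure))
        = (\<Prod>j\<in>UNIV. LINT t:{-1..1}|lborel. f j t * jacobi_weight \<alpha> \<beta> t)"
    unfolding weight_measure_def integral_density[OF m nn] integral_restrict_space[OF \<Omega>] prod_g
      integral_prod_component[OF g]
    by (simp add: g_def set_lebesgue_integral_def)
qed

section \<open>The space \<open>L2\<close> and the orthonormality of the Jacobi products\<close>

lemma L2_integrable_mult:
  assumes f: "f \<in> L2 \<alpha> \<beta>" and g: "g \<in> L2 \<alpha> \<beta>"
  shows "integrable (weight_measure \<alpha> \<beta>) (\<lambda>x. f x * g x)"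
proof (rule Bochner_Integration.integrable_bound)
  show "integrable (weight_measure \<alpha> \<beta>) (\<lambda>x. (f x)\<^sup>2 + (g x)\<^sup>2)"
    using f g by (simp add: L2_def)
  show "(\<lambda>x. f x * g x) \<in> borel_measurable (weight_measure \<alpha> \<beta>)"
    using f g by (auto simp: L2_def)
  have "\<bar>f x * g x\<bar> \<le> (f x)\<^sup>2 + (g x)\<^sup>2" for x
  proof -
    have "\<bar>f x\<bar> * \<bar>g x\<bar> \<le> 2 * \<bar>f x\<bar> * \<bar>g x\<bar>" by simp
    also have "\<dots> \<le> (f x)\<^sup>2 + (g x)\<^sup>2" using sum_squares_bound[of "\<bar>f x\<bar>" "\<bar>g x\<bar>"] by simp
    finally show ?thesis by (simp add: abs_mult)
  qed
  then show "AE x in weight_measure \<alpha> \<beta>. norm (f x * g x) \<le> norm ((f x)\<^sup>2 + (g x)\<^sup>2)" by simp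
qed

lemma subspace_L2: "subspace (L2 \<alpha> \<beta>)"
proof (rule subspaceI)
  show "0 \<in> L2 \<alpha> \<beta>" by (simp add: L2_def func_zero)
next
  fix f g :: "real ^ 's \<Rightarrow> real" assume fg: "f \<in> L2 \<alpha> \<beta>" "g \<in> L2 \<alpha> \<beta>"
  have "integrable (weight_measure \<alpha> \<beta>) (\<lambda>x. (f x)\<^sup>2 + (g x)\<^sup>2 + 2 * (f x * g x))"
    using fg L2_integrable_mult[OF fg] by (simp add: L2_def)
  then show "f + g \<in> L2 \<alpha> \<beta>" using fg by (simp add: L2_def func_plus power2_sum mult.assoc borel_measurable_add)
next
  fix f :: "real ^ 's \<Rightarrow> real" and c assume "f \<in> L2 \<alpha> \<beta>"
  then show "c *\<^sub>R f \<in> L2 \<alpha> \<beta>" by (simp add: L2_def scaleR_fun_def power_mult_distrib borel_measurable_times)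
qed

lemma semi_inner_product_space_L2: "semi_inner_product_space (L2 \<alpha> \<beta>) (inner_w \<alpha> \<beta>)"
proof
  show "inner_w \<alpha> \<beta> (f + g) h = inner_w \<alpha> \<beta> f h + inner_w \<alpha> \<beta> g h"
    if "f \<in> L2 \<alpha> \<beta>" "g \<in> L2 \<alpha> \<beta>" "h \<in> L2 \<alpha> \<beta>" for f g h :: "real ^ 's \<Rightarrow> real"
    using that by (simp add: inner_w_def distrib_right L2_integrable_mult)
  show "inner_w \<alpha> \<beta> (c *\<^sub>R f) h = c * inner_w \<alpha> \<beta> f h" for f h :: "real ^ 's \<Rightarrow> real" and c
    by (simp add: inner_w_def scaleR_fun_def mult.assoc)
  show "inner_w \<alpha> \<beta> f g = inner_w \<alpha> \<beta> g f" for f g :: "real ^ 's \<Rightarrow> real"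
    by (simp add: inner_w_def mult.commute)
  show "inner_w \<alpha> \<beta> f f \<ge> 0" for f :: "real ^ 's \<Rightarrow> real"
    unfolding inner_w_def by (intro Bochner_Integration.integral_nonneg) simp
qed (rule subspace_L2)

context
  fixes \<alpha> \<beta> :: real
  assumes ab: "\<alpha> > -1" "\<beta> > -1"
begin

lemma integrable_prod_poly:
  "integrable (weight_measure \<alpha> \<beta>) (\<lambda>x :: real ^ 's::finite. \<Prod>j\<in>UNIV. poly (q j) (x $ j))"
  by (intro integrable_weight_measure_prod poly_weight_integrable[OF ab]) measurable

lemma finite_measure_weight_measure: "finite_measure (weight_measure \<alpha> \<beta> :: (real ^ 's::finite) measure)"
proof
  have "integrable (weight_measure \<alpha> \<beta>) (\<lambda>_ :: real ^ 's. 1 :: real)"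
    using integrable_prod_poly[of "\<lambda>_. 1"] by simp
  then show "emeasure (weight_measure \<alpha> \<beta>) (space (weight_measure \<alpha> \<beta> :: (real ^ 's) measure)) \<noteq> \<infinity>"
    by (simp add: integrable_iff_bounded)
qed

lemma jacobi_prod_orthonormal:
  "inner_w \<alpha> \<beta> (jacobi_prod \<alpha> \<beta> k) (jacobi_prod \<alpha> \<beta> l) = (if k = (l :: nat ^ 's::finite) then 1 else 0)"
proof -
  have "inner_w \<alpha> \<beta> (jacobi_prod \<alpha> \<beta> k) (jacobi_prod \<alpha> \<beta> l)
      = (\<integral>x. (\<Prod>j\<in>UNIV. poly (jacobi \<alpha> \<beta> (k $ j) * jacobi \<alpha> \<beta> (l $ j)) (x $ j)) \<partial>(weight_measure \<alpha> \<beta> :: (real ^ 's) measure))"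
    by (simp add: inner_w_def jacobi_prod_def prod.distrib)
  also have "\<dots> = (\<Prod>j\<in>UNIV. poly_inner \<alpha> \<beta> (jacobi \<alpha> \<beta> (k $ j)) (jacobi \<alpha> \<beta> (l $ j)))"
    unfolding poly_inner_alt by (intro integral_weight_measure_prod poly_weight_integrable[OF ab]) measurable
  also have "\<dots> = (if k = l then 1 else 0)"
    unfolding jacobi_orthonormal[OF ab] by (auto simp: vec_eq_iff intro!: prod_zero)
  finally show ?thesis .
qed

lemma jacobi_prod_L2: "jacobi_prod \<alpha> \<beta> (k :: nat ^ 's::finite) \<in> L2 \<alpha> \<beta>"
proof -
  have "integrable (weight_measure \<alpha> \<beta>)
      (\<lambda>x :: real ^ 's. \<Prod>j\<in>UNIV. poly (jacobi \<alpha> \<beta> (k $ j) * jacobi \<alpha> \<beta> (k $ j)) (x $ j))"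
    by (rule integrable_prod_poly)
  then have "integrable (weight_measure \<alpha> \<beta>) (\<lambda>x. (jacobi_prod \<alpha> \<beta> k x)\<^sup>2)"
    by (simp add: jacobi_prod_def prod.distrib power2_eq_square)
  then show ?thesis
    unfolding L2_def jacobi_prod_def by (auto intro: borel_measurable_weight_measure)
qed

lemma orthonormal_family_jacobi:
  "orthonormal_family (L2 \<alpha> \<beta>) (inner_w \<alpha> \<beta>) (jacobi_prod \<alpha> \<beta> :: nat ^ 's::finite \<Rightarrow> _)"
  unfolding orthonormal_family_def orthonormal_family_axioms_def
  using semi_inner_product_space_L2 jacobi_prod_L2 jacobi_prod_orthonormal by blast

end

section \<open>Completeness of the Jacobi products\<close>

context
  fixes \<alpha> \<beta> :: real
  assumes ab: "\<alpha> > -1" "\<beta> > -1"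
begin

text \<open>The leading term is removed by a multiple of the Jacobi polynomial of the same degree.
  Bounding the degree through vanishing coefficients lets the induction start with the zero
  polynomial at \<open>n = 0\<close>.\<close>

lemma poly_jacobi_expansion:
  assumes "\<forall>i\<ge>n. coeff q i = 0"
  shows "\<exists>c. q = (\<Sum>i<n. smult (c i) (jacobi \<alpha> \<beta> i))"
  using assms
proof (induction n arbitrary: q)
  case 0
  then show ?case by (auto simp: poly_eq_iff)
next
  case (Suc n)
  have J: "degree (jacobi \<alpha> \<beta> n) = n" "coeff (jacobi \<alpha> \<beta> n) n > 0"
    using is_jacobi_jacobi[OF ab, of n] by (auto simp: is_jacobi_def)
  define d where "d = coeff q n / coeff (jacobi \<alpha> \<beta> n) n"
  have "\<forall>i\<ge>n. coeff (q - smult d (jacobi \<alpha> \<beta> n)) i = 0"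
  proof (intro allI impI)
    fix i assume "i \<ge> n"
    then show "coeff (q - smult d (jacobi \<alpha> \<beta> n)) i = 0"
      using Suc.prems J by (cases "i = n") (auto simp: d_def coeff_eq_0)
  qed
  then obtain c where c: "q - smult d (jacobi \<alpha> \<beta> n) = (\<Sum>i<n. smult (c i) (jacobi \<alpha> \<beta> i))"
    using Suc.IH by blast
  have "(\<Sum>i<n. smult ((c(n := d)) i) (jacobi \<alpha> \<beta> i)) = (\<Sum>i<n. smult (c i) (jacobi \<alpha> \<beta> i))"
    by (intro sum.cong) auto
  then have "q = (\<Sum>i<Suc n. smult ((c(n := d)) i) (jacobi \<alpha> \<beta> i))"
    by (simp flip: c)
  then show ?case by blast
qed

lemma prod_poly_in_span:
  "(\<lambda>x :: real ^ 's::finite. \<Prod>j\<in>UNIV. poly (q j) (x $ j)) \<in> span (range (jacobi_prod \<alpha> \<beta>))"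
proof -
  have "\<exists>c. q j = (\<Sum>i<Suc (degree (q j)). smult (c i) (jacobi \<alpha> \<beta> i))" for j
    by (rule poly_jacobi_expansion) (auto intro: coeff_eq_0)
  then obtain c where c: "\<And>j. q j = (\<Sum>i<Suc (degree (q j)). smult (c j i) (jacobi \<alpha> \<beta> i))" by metis
  define P where "P = PiE UNIV (\<lambda>j. {..<Suc (degree (q j))})"
  have "(\<lambda>x :: real ^ 's. \<Prod>j\<in>UNIV. poly (q j) (x $ j))
      = (\<Sum>k\<in>P. (\<Prod>j\<in>UNIV. c j (k j)) *\<^sub>R jacobi_prod \<alpha> \<beta> (\<chi> j. k j))"
  proof
    fix x :: "real ^ 's"
    have "(\<Prod>j\<in>UNIV. poly (q j) (x $ j))
        = (\<Prod>j\<in>UNIV. \<Sum>i<Suc (degree (q j)). c j i * poly (jacobi \<alpha> \<beta> i) (x $ j))"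
      by (subst c) (simp only: poly_sum poly_smult)
    also have "\<dots> = (\<Sum>k\<in>P. \<Prod>j\<in>UNIV. c j (k j) * poly (jacobi \<alpha> \<beta> (k j)) (x $ j))"
      unfolding P_def by (intro prod_sum_PiE) auto
    also have "\<dots> = (\<Sum>k\<in>P. (\<Prod>j\<in>UNIV. c j (k j)) *\<^sub>R jacobi_prod \<alpha> \<beta> (\<chi> j. k j)) x"
      unfolding sum_fun_apply by (simp add: scaleR_fun_def jacobi_prod_def prod.distrib)
    finally show "(\<Prod>j\<in>UNIV. poly (q j) (x $ j))
        = (\<Sum>k\<in>P. (\<Prod>j\<in>UNIV. c j (k j)) *\<^sub>R jacobi_prod \<alpha> \<beta> (\<chi> j. k j)) x" .
  qed
  also have "\<dots> \<in> span (range (jacobi_prod \<alpha> \<beta>))"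
    by (intro span_sum span_scale span_base) auto
  finally show ?thesis .
qed

text \<open>Products of one-variable polynomials are closed under multiplication, so their span is
  an algebra. It contains the constants and the coordinates, hence all polynomial functions.\<close>

lemma real_polynomial_function_in_span:
  fixes p :: "real ^ 's::finite \<Rightarrow> real"
  assumes "real_polynomial_function p"
  shows "p \<in> span (range (jacobi_prod \<alpha> \<beta>))"
proof -
  define M where "M = range (\<lambda>q (x :: real ^ 's). \<Prod>j\<in>UNIV. poly (q j) (x $ j))"
  have M_I: "(\<lambda>x. \<Prod>j\<in>UNIV. poly (q j) (x $ j)) \<in> M" for q by (auto simp: M_def)
  have M_mult: "u * v \<in> M" if uv: "u \<in> M" "v \<in> M" for u v
  proof -
    from uv obtain q q' where "u = (\<lambda>x. \<Prod>j\<in>UNIV. poly (q j) (x $ j))" "v = (\<lambda>x. \<Prod>j\<in>UNIV. poly (q' j) (x $ j))"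
      by (auto simp: M_def)
    then have "u * v = (\<lambda>x. \<Prod>j\<in>UNIV. poly (q j * q' j) (x $ j))"
      by (simp add: func_times prod.distrib)
    then show ?thesis using M_I[of "\<lambda>j. q j * q' j"] by simp
  qed
  have scale_mult: "(c *\<^sub>R f) * g = c *\<^sub>R (f * g)" for c and f g :: "real ^ 's \<Rightarrow> real"
    by (simp add: fun_eq_iff scaleR_fun_def)
  have span_mult_M: "u * v \<in> span M" if "u \<in> span M" "v \<in> M" for u v
    using that(1)
  proof (induction rule: span_induct_alt)
    case (step c x y)
    have "(c *\<^sub>R x + y) * v = c *\<^sub>R (x * v) + y * v" by (simp add: distrib_right scale_mult)
    then show ?case
      by (simp only:) (intro span_add span_scale span_base M_mult step that(2))
  next
    case base
    have "0 * v = 0" by simp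
    then show ?case by (simp only: span_zero)
  qed
  have span_mult: "v * u \<in> span M" if "u \<in> span M" "v \<in> span M" for u v
    using that(2)
  proof (induction rule: span_induct_alt)
    case (step c x y)
    have "(c *\<^sub>R x + y) * u = c *\<^sub>R (u * x) + y * u"
      by (simp add: fun_eq_iff scaleR_fun_def algebra_simps)
    then show ?case
      by (simp only:) (intro span_add span_scale span_mult_M step that(1))
  next
    case base
    have "0 * u = 0" by simp
    then show ?case by (simp only: span_zero)
  qed
  have const: "(\<lambda>x. c) \<in> span M" for c
  proof -
    have "(\<lambda>x :: real ^ 's. \<Prod>j\<in>(UNIV :: 's set). poly 1 (x $ j)) \<in> M" by (rule M_I)
    then have "c *\<^sub>R (\<lambda>x :: real ^ 's. \<Prod>j\<in>(UNIV :: 's set). poly 1 (x $ j)) \<in> span M"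
      by (intro span_scale span_base)
    then show ?thesis by (simp add: scaleR_fun_def)
  qed
  have coord: "(\<lambda>x. x $ i) \<in> M" for i
  proof -
    have "(\<lambda>x :: real ^ 's. x $ i) = (\<lambda>x. \<Prod>j\<in>UNIV. poly (if j = i then [:0, 1:] else 1) (x $ j))"
    proof
      fix x :: "real ^ 's"
      have "(\<Prod>j\<in>UNIV. poly (if j = i then [:0, 1:] else 1) (x $ j)) = (\<Prod>j\<in>UNIV. if j = i then x $ j else 1)"
        by (intro prod.cong) auto
      then show "x $ i = (\<Prod>j\<in>UNIV. poly (if j = i then [:0, 1:] else 1) (x $ j))" by simp
    qed
    then show ?thesis using M_I[of "\<lambda>j. if j = i then [:0, 1:] else 1"] by simp
  qed
  have "p \<in> span M"
    using assms
  proof induction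
    case (linear f)
    have "f = (\<Sum>i\<in>UNIV. f (axis i 1) *\<^sub>R (\<lambda>x. x $ i))"
    proof
      fix x :: "real ^ 's"
      have "f x = f (\<Sum>i\<in>UNIV. x $ i *\<^sub>R axis i 1)"
        by (rule arg_cong[of _ _ f]) (simp add: vec_eq_iff axis_def if_distrib cong: if_cong)
      also have "\<dots> = (\<Sum>i\<in>UNIV. x $ i *\<^sub>R f (axis i 1))"
        using linear by (simp add: bounded_linear.linear linear_sum linear_scale)
      finally show "f x = (\<Sum>i\<in>UNIV. f (axis i 1) *\<^sub>R (\<lambda>x. x $ i)) x"
        by (simp add: sum_fun_apply scaleR_fun_def mult.commute)
    qed
    moreover have "(\<Sum>i\<in>UNIV. f (axis i 1) *\<^sub>R (\<lambda>x. x $ i)) \<in> span M"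
      by (intro span_sum span_scale span_base coord)
    ultimately show ?case by simp
  next
    case (const c)
    then show ?case by (rule \<open>\<And>c. (\<lambda>x. c) \<in> span M\<close>)
  next
    case (add f g)
    then show ?case using span_add[of f M g] by (simp add: func_plus)
  next
    case (mult f g)
    then show ?case using span_mult[of g f] by (simp add: func_times)
  qed
  also have "span M \<subseteq> span (range (jacobi_prod \<alpha> \<beta>))"
    by (intro span_minimal subspace_span) (auto simp: M_def prod_poly_in_span)
  finally show ?thesis .
qed

lemma L2_bounded:
  fixes f :: "real ^ 's::finite \<Rightarrow> real"
  assumes f: "f \<in> borel_measurable (weight_measure \<alpha> \<beta>)" and B: "\<And>x. x \<in> unit_cube \<Longrightarrow> \<bar>f x\<bar> \<le> B"
  shows "f \<in> L2 \<alpha> \<beta>"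
proof -
  interpret finite_measure "weight_measure \<alpha> \<beta> :: (real ^ 's) measure"
    by (rule finite_measure_weight_measure[OF ab])
  have "(f x)\<^sup>2 \<le> B\<^sup>2" if "x \<in> unit_cube" for x
    using B[OF that] by (metis abs_ge_zero power2_abs power_mono)
  then have "integrable (weight_measure \<alpha> \<beta>) (\<lambda>x. (f x)\<^sup>2)"
    using f by (intro integrable_const_bound[where B = "B\<^sup>2"] borel_measurable_power) auto
  then show ?thesis using f by (simp add: L2_def)
qed

text \<open>Dominated convergence in the form needed twice for density: for truncation and for
  approximation by continuous functions.\<close>

lemma integral_square_tendsto_0:
  fixes f :: "real ^ 's::finite \<Rightarrow> real" and h :: "nat \<Rightarrow> real ^ 's \<Rightarrow> real"
  assumes f: "f \<in> borel_measurable (weight_measure \<alpha> \<beta>)"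
    and h: "\<And>n. h n \<in> borel_measurable (weight_measure \<alpha> \<beta>)"
    and w: "integrable (weight_measure \<alpha> \<beta>) w"
    and bound: "\<And>n x. x \<in> unit_cube \<Longrightarrow> (f x - h n x)\<^sup>2 \<le> w x"
    and lim: "AE x in weight_measure \<alpha> \<beta>. (\<lambda>n. h n x) \<longlonglongrightarrow> f x"
    and \<delta>: "\<delta> > 0"
  shows "\<exists>n. (\<integral>x. (f x - h n x)\<^sup>2 \<partial>weight_measure \<alpha> \<beta>) < \<delta>"
proof -
  have "(\<lambda>n. \<integral>x. (f x - h n x)\<^sup>2 \<partial>weight_measure \<alpha> \<beta>) \<longlonglongrightarrow> (\<integral>x. 0 \<partial>(weight_measure \<alpha> \<beta> :: (real ^ 's) measure))"
  proof (rule integral_dominated_convergence[OF _ _ w])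
    show "(\<lambda>x. (f x - h n x)\<^sup>2) \<in> borel_measurable (weight_measure \<alpha> \<beta>)" for n
      using f h by (intro borel_measurable_power borel_measurable_diff)
    show "AE x in weight_measure \<alpha> \<beta>. (\<lambda>n. (f x - h n x)\<^sup>2) \<longlonglongrightarrow> 0"
      using lim
    proof eventually_elim
      case (elim x)
      then have "(\<lambda>n. (f x - h n x)\<^sup>2) \<longlonglongrightarrow> (f x - f x)\<^sup>2" by (intro tendsto_intros)
      then show ?case by simp
    qed
  qed (use bound in auto)
  then have "\<forall>\<^sub>F n in sequentially. (\<integral>x. (f x - h n x)\<^sup>2 \<partial>weight_measure \<alpha> \<beta>) < \<delta>"
    using \<delta> by (intro order_tendstoD) auto
  then show ?thesis by (auto simp: eventually_sequentially)
qed

text \<open>Three successive approximations: truncation to a bounded function, a continuous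
  function, a polynomial. Each squared error is at most \<open>\<delta> / 9\<close>, and the square
  of a sum of three terms is at most three times the sum of the squares.\<close>

lemma jacobi_prod_dense:
  fixes f :: "real ^ 's::finite \<Rightarrow> real"
  assumes f: "f \<in> L2 \<alpha> \<beta>" and \<delta>: "\<delta> > 0"
  shows "\<exists>g\<in>span (range (jacobi_prod \<alpha> \<beta>)). inner_w \<alpha> \<beta> (f - g) (f - g) < \<delta>"
proof -
  let ?\<mu> = "weight_measure \<alpha> \<beta> :: (real ^ 's) measure"
  interpret finite_measure ?\<mu> by (rule finite_measure_weight_measure[OF ab])
  define clamp where "clamp = (\<lambda>B t :: real. max (- B) (min B t))"
  have f_meas: "f \<in> borel_measurable ?\<mu>" and f_int: "integrable ?\<mu> (\<lambda>x. (f x)\<^sup>2)"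
    using f by (auto simp: L2_def)
  have "\<exists>n. (\<integral>x. (f x - clamp (real n) (f x))\<^sup>2 \<partial>?\<mu>) < \<delta> / 9"
  proof (rule integral_square_tendsto_0[OF f_meas _ f_int])
    show "(\<lambda>x. clamp (real n) (f x)) \<in> borel_measurable ?\<mu>" for n
      using f_meas by (simp add: clamp_def)
    show "(f x - clamp (real n) (f x))\<^sup>2 \<le> (f x)\<^sup>2" for n x
    proof -
      have "\<bar>f x - clamp (real n) (f x)\<bar> \<le> \<bar>f x\<bar>" by (auto simp: clamp_def)
      then show ?thesis by (simp add: abs_le_square_iff)
    qed
    show "AE x in ?\<mu>. (\<lambda>n. clamp (real n) (f x)) \<longlonglongrightarrow> f x"
    proof (intro AE_I2 tendsto_eventually)
      fix x
      obtain N :: nat where "\<bar>f x\<bar> \<le> real N" using real_arch_simple by blast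
      then show "\<forall>\<^sub>F n in sequentially. clamp (real n) (f x) = f x"
        unfolding eventually_sequentially by (intro exI[of _ N]) (auto simp: clamp_def)
    qed
  qed (use \<delta> in auto)
  then obtain n where n: "(\<integral>x. (f x - clamp (real n) (f x))\<^sup>2 \<partial>?\<mu>) < \<delta> / 9" by blast
  define B where "B = real n"
  define fB where "fB = (\<lambda>x. clamp B (f x))"
  have fB_meas: "fB \<in> borel_measurable ?\<mu>" using f_meas by (simp add: fB_def clamp_def)
  have clamp_B: "\<bar>clamp B t\<bar> \<le> B" for t by (auto simp: clamp_def B_def)
  have fB_L2: "fB \<in> L2 \<alpha> \<beta>" using fB_meas clamp_B by (intro L2_bounded[where B = B]) (auto simp: fB_def)

  have "(\<lambda>x. indicator unit_cube x * fB x) \<in> borel_measurable lebesgue"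
    using fB_meas unfolding borel_measurable_weight_measure_iff by (simp add: measurable_completion)
  then have "(\<lambda>x. indicator unit_cube x * fB x) measurable_on UNIV"
    by (rule lebesgue_measurable_imp_measurable_on_real) simp
  \<comment> \<open>A Lebesgue measurable function is an almost everywhere limit of continuous
    functions. Clamping them to \<open>[-B, B]\<close> keeps continuity, does not disturb the limit,
    and makes the convergence dominated.\<close>
  then obtain N g where N: "negligible N" and g: "\<And>n. continuous_on UNIV (g n)"
      and g_lim: "\<And>x. x \<notin> N \<Longrightarrow> (\<lambda>n. g n x) \<longlonglongrightarrow> indicator unit_cube x * fB x"
    unfolding measurable_on_def by auto
  have g_cont: "continuous_on UNIV (\<lambda>x. clamp B (g n x))" for n
    unfolding clamp_def by (intro continuous_intros g)
  have g_meas: "(\<lambda>x. clamp B (g n x)) \<in> borel_measurable ?\<mu>" for n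
    by (intro borel_measurable_weight_measure borel_measurable_continuous_onI g_cont)
  have "\<exists>n. (\<integral>x. (fB x - clamp B (g n x))\<^sup>2 \<partial>?\<mu>) < \<delta> / 9"
  proof (rule integral_square_tendsto_0[OF fB_meas g_meas, where w = "\<lambda>_. (2 * B)\<^sup>2"])
    show "(fB x - clamp B (g n x))\<^sup>2 \<le> (2 * B)\<^sup>2" for n x
      using clamp_B[of "f x"] clamp_B[of "g n x"]
      by (subst abs_le_square_iff[symmetric]) (auto simp: fB_def)
    \<comment> \<open>The exceptional set is only Lebesgue null; it is enclosed in a Borel null set
      to get a statement about \<open>lborel\<close>.\<close>
    obtain N' where N': "N' \<in> null_sets lborel" "N \<subseteq> N'"
      using N by (auto simp: negligible_iff_null_sets null_sets_completion_iff2)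
    have "AE x in lborel. x \<in> unit_cube \<longrightarrow> (\<lambda>n. clamp B (g n x)) \<longlonglongrightarrow> fB x"
      using AE_not_in[OF N'(1)]
    proof eventually_elim
      case (elim x)
      show ?case
      proof
        assume "x \<in> unit_cube"
        then have "(\<lambda>n. g n x) \<longlonglongrightarrow> fB x" using g_lim[of x] elim N'(2) by auto
        then have "(\<lambda>n. clamp B (g n x)) \<longlonglongrightarrow> clamp B (fB x)"
          unfolding clamp_def by (intro tendsto_intros)
        also have "clamp B (fB x) = fB x" using clamp_B[of "f x"] by (auto simp: fB_def clamp_def)
        finally show "(\<lambda>n. clamp B (g n x)) \<longlonglongrightarrow> fB x" .
      qed
    qed
    then show "AE x in ?\<mu>. (\<lambda>n. clamp B (g n x)) \<longlonglongrightarrow> fB x" by (rule AE_weight_measure)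
  qed (use \<delta> in auto)
  then obtain m where m: "(\<integral>x. (fB x - clamp B (g m x))\<^sup>2 \<partial>?\<mu>) < \<delta> / 9" by blast
  define h where "h = (\<lambda>x. clamp B (g m x))"
  have h_L2: "h \<in> L2 \<alpha> \<beta>" unfolding h_def using g_meas clamp_B by (intro L2_bounded[where B = B]) auto

  \<comment> \<open>A uniform error \<open>\<eta>\<close> costs \<open>\<eta>\<^sup>2\<close> times
    the total mass. The summand 1 keeps the denominator positive without a lower bound for the
    mass.\<close>
  define \<eta> where "\<eta> = sqrt (\<delta> / (9 * (measure ?\<mu> unit_cube + 1)))"
  have pos: "9 * (measure ?\<mu> unit_cube + 1) > 0" by (simp add: add_nonneg_pos)
  have \<eta>: "\<eta> > 0" "\<eta>\<^sup>2 = \<delta> / (9 * (measure ?\<mu> unit_cube + 1))"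
    using \<delta> pos by (auto simp: \<eta>_def)
  obtain p where p: "real_polynomial_function p" "\<And>x. x \<in> unit_cube \<Longrightarrow> \<bar>h x - p x\<bar> < \<eta>"
    using Stone_Weierstrass_real_polynomial_function[OF compact_unit_cube
        continuous_on_subset[OF g_cont[of m] subset_UNIV] \<eta>(1)] by (auto simp: h_def)
  have p_span: "p \<in> span (range (jacobi_prod \<alpha> \<beta>))" by (rule real_polynomial_function_in_span[OF p(1)])
  have p_L2: "p \<in> L2 \<alpha> \<beta>"
    using p_span span_minimal[OF _ subspace_L2, of "range (jacobi_prod \<alpha> \<beta>)"] jacobi_prod_L2[OF ab] by blast
  have sq_int: "integrable ?\<mu> (\<lambda>x. (u x - v x)\<^sup>2)" if "u \<in> L2 \<alpha> \<beta>" "v \<in> L2 \<alpha> \<beta>" for u v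
    using subspace_diff[OF subspace_L2 that] by (simp add: L2_def)
  have "(\<integral>x. (h x - p x)\<^sup>2 \<partial>?\<mu>) \<le> (\<integral>x. \<eta>\<^sup>2 \<partial>?\<mu>)"
  proof (intro integral_mono sq_int h_L2 p_L2)
    fix x assume "x \<in> space ?\<mu>"
    then show "(h x - p x)\<^sup>2 \<le> \<eta>\<^sup>2"
      using p(2)[of x] \<eta>(1) by (subst abs_le_square_iff[symmetric]) auto
  qed simp
  also have "\<dots> = measure ?\<mu> unit_cube * \<eta>\<^sup>2" by simp
  also have "\<dots> \<le> \<delta> / 9" using \<delta> pos unfolding \<eta>(2) by (simp add: field_simps)
  finally have hp: "(\<integral>x. (h x - p x)\<^sup>2 \<partial>?\<mu>) \<le> \<delta> / 9" .

  have "inner_w \<alpha> \<beta> (f - p) (f - p) = (\<integral>x. (f x - p x)\<^sup>2 \<partial>?\<mu>)"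
    by (simp add: inner_w_def power2_eq_square)
  also have "\<dots> \<le> (\<integral>x. 3 * (f x - fB x)\<^sup>2 + 3 * (fB x - h x)\<^sup>2 + 3 * (h x - p x)\<^sup>2 \<partial>?\<mu>)"
  proof (intro integral_mono)
    show "(f x - p x)\<^sup>2 \<le> 3 * (f x - fB x)\<^sup>2 + 3 * (fB x - h x)\<^sup>2 + 3 * (h x - p x)\<^sup>2" for x
    proof -
      have "3 * u\<^sup>2 + 3 * v\<^sup>2 + 3 * w\<^sup>2 - (u + v + w)\<^sup>2 = (u - v)\<^sup>2 + (v - w)\<^sup>2 + (u - w)\<^sup>2" for u v w :: real
        by (simp add: power2_eq_square algebra_simps)
      from this[of "f x - fB x" "fB x - h x" "h x - p x"] show ?thesis
        by (smt (verit) zero_le_power2)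
    qed
  qed (auto intro!: sq_int f fB_L2 h_L2 p_L2 integrable_mult_right)
  also have "\<dots> = 3 * (\<integral>x. (f x - fB x)\<^sup>2 \<partial>?\<mu>) + 3 * (\<integral>x. (fB x - h x)\<^sup>2 \<partial>?\<mu>) + 3 * (\<integral>x. (h x - p x)\<^sup>2 \<partial>?\<mu>)"
    using sq_int[OF f fB_L2] sq_int[OF fB_L2 h_L2] sq_int[OF h_L2 p_L2] by simp
  also have "\<dots> < \<delta>" using n m hp by (simp add: fB_def h_def B_def)
  finally show ?thesis using p_span by blast
qed

end

section \<open>Counting points of hyperbolic crosses\<close>

text \<open>Lists instead of \<open>nat ^ 's\<close>, because the induction runs over the number of
  coordinates, which a type cannot vary.\<close>

definition hyp_cross :: "real \<Rightarrow> nat \<Rightarrow> real \<Rightarrow> nat list set" where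
  "hyp_cross a s T = {ks. length ks = s \<and> (\<Prod>k\<leftarrow>ks. a + real k) < T}"

lemma prod_list_ge_power:
  assumes "a > 0"
  shows "a ^ length ks \<le> (\<Prod>k\<leftarrow>ks. a + real k)"
proof (induction ks)
  case (Cons k ks)
  have "a * a ^ length ks \<le> (a + real k) * (\<Prod>k\<leftarrow>ks. a + real k)"
    using assms Cons by (intro mult_mono) auto
  then show ?case by simp
qed simp

text \<open>Slicing by the first entry. The other \<open>s\<close> factors have product at least
  \<open>a ^ s\<close>, so the hypothesis on \<open>M\<close> makes all slices with
  \<open>k \<ge> M\<close> empty.\<close>

lemma hyp_cross_Suc:
  assumes "a > 0" "T \<le> a ^ s * (a + real M)"
  shows "hyp_cross a (Suc s) T = (\<Union>k<M. Cons k ` hyp_cross a s (T / (a + real k)))"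
proof (intro set_eqI iffI)
  fix ks assume "ks \<in> hyp_cross a (Suc s) T"
  then obtain k ks' where ks: "ks = k # ks'" "length ks' = s"
      "(a + real k) * (\<Prod>k\<leftarrow>ks'. a + real k) < T"
    by (auto simp: hyp_cross_def length_Suc_conv)
  have "(a + real k) * a ^ s \<le> (a + real k) * (\<Prod>k\<leftarrow>ks'. a + real k)"
    using prod_list_ge_power[OF assms(1), of ks'] ks(2) assms(1) by (intro mult_left_mono) auto
  then have "a ^ s * (a + real k) < a ^ s * (a + real M)"
    using ks(3) assms(2) by (simp add: mult.commute)
  then have "k < M" using assms(1) by simp
  moreover have "ks' \<in> hyp_cross a s (T / (a + real k))"
    using ks assms(1) by (simp add: hyp_cross_def pos_less_divide_eq mult.commute)
  ultimately show "ks \<in> (\<Union>k<M. Cons k ` hyp_cross a s (T / (a + real k)))" using ks(1) by auto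
qed (use assms(1) in \<open>auto simp: hyp_cross_def pos_less_divide_eq mult.commute\<close>)

lemma finite_hyp_cross:
  assumes "a > 0"
  shows "finite (hyp_cross a s T)"
proof (induction s arbitrary: T)
  case 0
  have "hyp_cross a 0 T \<subseteq> {[]}" by (auto simp: hyp_cross_def)
  then show ?case using finite_subset by blast
next
  case (Suc s)
  obtain M :: nat where "T / a ^ s \<le> real M" using real_arch_simple by blast
  then have "T / a ^ s \<le> a + real M" using assms by simp
  then have "T \<le> a ^ s * (a + real M)" using assms by (simp add: pos_divide_le_eq mult.commute)
  then show ?case using hyp_cross_Suc[OF assms] Suc by simp
qed

definition hyp_count :: "real \<Rightarrow> nat \<Rightarrow> real \<Rightarrow> nat" where
  "hyp_count a s T = card (hyp_cross a s T)"

lemma hyp_count_mono: "a > 0 \<Longrightarrow> T \<le> T' \<Longrightarrow> hyp_count a s T \<le> hyp_count a s T'"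
  unfolding hyp_count_def
  by (intro card_mono finite_hyp_cross) (auto simp: hyp_cross_def)

lemma hyp_count_Suc:
  assumes "a > 0" "T \<le> a ^ s * (a + real M)"
  shows "hyp_count a (Suc s) T = (\<Sum>k<M. hyp_count a s (T / (a + real k)))"
  unfolding hyp_count_def hyp_cross_Suc[OF assms]
  by (subst card_UN_disjoint) (auto simp: finite_hyp_cross[OF assms(1)] card_image)

lemma add_less_iff_nat_ceiling: "a + real k < T \<longleftrightarrow> k < nat \<lceil>T - a\<rceil>"
  by linarith

lemma hyp_count_1: "hyp_count a (Suc 0) T = nat \<lceil>T - a\<rceil>"
proof -
  have "hyp_cross a (Suc 0) T = (\<lambda>k. [k]) ` {..<nat \<lceil>T - a\<rceil>}"
    by (auto simp: hyp_cross_def length_Suc_conv add_less_iff_nat_ceiling[symmetric])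
  then show ?thesis by (simp add: hyp_count_def card_image inj_on_def)
qed

section \<open>Comparison of sums with integrals\<close>

lemma sum_increments_ge:
  fixes A h :: "real \<Rightarrow> real"
  assumes "\<And>k. k < M \<Longrightarrow> h (a + real k) \<le> A (c + real (Suc k)) - A (c + real k)"
  shows "(\<Sum>k<M. h (a + real k)) \<le> A (c + real M) - A c"
proof -
  have "(\<Sum>k<M. h (a + real k)) \<le> (\<Sum>k<M. A (c + real (Suc k)) - A (c + real k))"
    using assms by (intro sum_mono) auto
  also have "\<dots> = A (c + real M) - A c"
    by (subst sum_lessThan_telescope[of "\<lambda>k. A (c + real k)"]) simp
  finally show ?thesis .
qed

text \<open>A quantitative Hermite--Hadamard inequality: the integral of a convex function over an interval
  of length one exceeds its value at the midpoint by at least \<open>\<kappa> / 24\<close> if its second derivative is at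
  least \<open>\<kappa>\<close>. The lemma speaks of an antiderivative \<open>A\<close> instead of the integral.\<close>
lemma midpoint_le_increment:
  fixes A h g :: "real \<Rightarrow> real"
  assumes A: "\<And>x. x \<in> {c - 1/2..c + 1/2} \<Longrightarrow> (A has_real_derivative h x) (at x)"
    and h: "\<And>x. x \<in> {c - 1/2..c + 1/2} \<Longrightarrow> (h has_real_derivative g x) (at x)"
    and g: "\<And>x y. c - 1/2 \<le> x \<Longrightarrow> x \<le> y \<Longrightarrow> y \<le> c + 1/2 \<Longrightarrow> \<kappa> * (y - x) \<le> g y - g x"
  shows "h c + \<kappa> / 24 \<le> A (c + 1/2) - A (c - 1/2)"
proof -
  \<comment> \<open>The derivative in \<open>u\<close> is
    \<open>g (c + u) - g (c - u) - 2 * \<kappa> * u\<close>, which is nonnegative by the growth of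
    \<open>g\<close>.\<close>
  have E: "0 \<le> h (c + u) + h (c - u) - 2 * h c - \<kappa> * u\<^sup>2" if u: "0 \<le> u" "u \<le> 1/2" for u
  proof -
    have "(\<lambda>u. h (c + u) + h (c - u) - 2 * h c - \<kappa> * u\<^sup>2) 0
        \<le> (\<lambda>u. h (c + u) + h (c - u) - 2 * h c - \<kappa> * u\<^sup>2) u"
    proof (rule DERIV_nonneg_imp_nondecreasing[OF u(1)], intro exI conjI)
      fix x assume x: "0 \<le> x" "x \<le> u"
      show "((\<lambda>u. h (c + u) + h (c - u) - 2 * h c - \<kappa> * u\<^sup>2) has_real_derivative
          g (c + x) - g (c - x) - 2 * \<kappa> * x) (at x)"
        using x u by (auto intro!: derivative_eq_intros DERIV_chain2[OF h])
      show "0 \<le> g (c + x) - g (c - x) - 2 * \<kappa> * x"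
        using g[of "c - x" "c + x"] x u by (simp add: algebra_simps)
    qed
    then show ?thesis by simp
  qed
  \<comment> \<open>This integrates the preceding inequality over \<open>{0..1/2}\<close>; the
    constant 24 is \<open>3 * 2 ^ 3\<close>, from the integral of \<open>u\<^sup>2\<close>.\<close>
  have "(\<lambda>u. A (c + u) - A (c - u) - 2 * u * h c - \<kappa> * u ^ 3 / 3) 0
      \<le> (\<lambda>u. A (c + u) - A (c - u) - 2 * u * h c - \<kappa> * u ^ 3 / 3) (1/2)"
  proof (rule DERIV_nonneg_imp_nondecreasing, simp, intro exI conjI)
    fix x :: real assume x: "0 \<le> x" "x \<le> 1/2"
    show "((\<lambda>u. A (c + u) - A (c - u) - 2 * u * h c - \<kappa> * u ^ 3 / 3) has_real_derivative
        h (c + x) + h (c - x) - 2 * h c - \<kappa> * x\<^sup>2) (at x)"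
      using x by (auto intro!: derivative_eq_intros DERIV_chain2[OF A])
    show "0 \<le> h (c + x) + h (c - x) - 2 * h c - \<kappa> * x\<^sup>2" by (rule E[OF x])
  qed
  then show ?thesis by (simp add: power3_eq_cube)
qed

text \<open>The constant comes from \<open>x + y \<ge> 2 * b\<close> and
  \<open>x, y \<le> b + 1\<close>. It serves as \<open>\<kappa>\<close> on the first interval
  \<open>{b..b + 1}\<close>, where the gain is collected.\<close>

lemma inverse_square_increment_ge:
  fixes b x y :: real
  assumes b: "b > 0" and xy: "b \<le> x" "x \<le> y" "y \<le> b + 1"
  shows "2 * b / (b + 1) ^ 4 * (y - x) \<le> 1 / x\<^sup>2 - 1 / y\<^sup>2"
proof -
  have eq: "1 / x\<^sup>2 - 1 / y\<^sup>2 = (x + y) / (x\<^sup>2 * y\<^sup>2) * (y - x)"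
    using b xy by (simp add: field_simps power2_eq_square)
  have "x\<^sup>2 * y\<^sup>2 \<le> (b + 1)\<^sup>2 * (b + 1)\<^sup>2"
    using b xy by (intro mult_mono power_mono) auto
  then have "x\<^sup>2 * y\<^sup>2 \<le> (b + 1) ^ 4" by (simp flip: power_add)
  then have "2 * b / (b + 1) ^ 4 \<le> (x + y) / (x\<^sup>2 * y\<^sup>2)"
    using b xy by (intro frac_le) auto
  then have "2 * b / (b + 1) ^ 4 * (y - x) \<le> (x + y) / (x\<^sup>2 * y\<^sup>2) * (y - x)"
    using xy by (intro mult_right_mono) auto
  then show ?thesis by (simp only: eq)
qed

text \<open>For \<open>t \<ge> 0\<close> both functions below equal the integral of \<open>exp \<tau> * \<tau> ^ n / fact n\<close> over \<open>{0..t}\<close>,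
  that is the volume of the points \<open>x\<close> with \<open>n + 1\<close> coordinates, all at least \<open>1\<close>, whose product is at
  most \<open>exp t\<close>. The second one is cut off at \<open>0\<close>.\<close>
primrec exp_poly_int :: "nat \<Rightarrow> real \<Rightarrow> real" where
  "exp_poly_int 0 t = exp t - 1"
| "exp_poly_int (Suc n) t = exp t * t ^ Suc n / fact (Suc n) - exp_poly_int n t"

definition cross_int :: "nat \<Rightarrow> real \<Rightarrow> real" where
  "cross_int n t = exp_poly_int n (max 0 t)"

lemma exp_poly_int_0 [simp]: "exp_poly_int n 0 = 0"
  by (induction n) auto

lemma cross_int_nonpos [simp]: "t \<le> 0 \<Longrightarrow> cross_int n t = 0"
  by (simp add: cross_int_def max_absorb1)

lemma cross_int_Suc:
  "cross_int (Suc n) t = exp t * max 0 t ^ Suc n / fact (Suc n) - cross_int n t"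
  by (cases "t \<le> 0") (simp_all add: cross_int_def max_def)

lemma DERIV_exp_poly_int: "(exp_poly_int n has_real_derivative exp t * t ^ n / fact n) (at t)"
proof (induction n)
  case 0
  show ?case by (auto intro!: derivative_eq_intros)
next
  case (Suc n)
  have "((\<lambda>t. exp t * t ^ Suc n / fact (Suc n) - exp_poly_int n t) has_real_derivative
      (exp t * t ^ Suc n + exp t * (real (Suc n) * t ^ n)) / fact (Suc n) - exp t * t ^ n / fact n) (at t)"
    by (rule derivative_eq_intros Suc refl | simp)+
  also have "exp t * (real (Suc n) * t ^ n) = real (Suc n) * (exp t * t ^ n)" by simp
  finally show ?case by (simp add: add_divide_distrib)
qed

lemma exp_poly_int_mono: "0 \<le> x \<Longrightarrow> x \<le> y \<Longrightarrow> exp_poly_int n x \<le> exp_poly_int n y"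
  by (rule DERIV_nonneg_imp_nondecreasing) (auto intro!: exI[of _ "exp _ * _ ^ n / fact n"] DERIV_exp_poly_int)

lemma cross_int_mono: "x \<le> y \<Longrightarrow> cross_int n x \<le> cross_int n y"
  unfolding cross_int_def by (intro exp_poly_int_mono) auto

lemma cross_int_nonneg: "cross_int n t \<ge> 0"
  using exp_poly_int_mono[of 0 "max 0 t" n] by (simp add: cross_int_def)

text \<open>At \<open>t = 0\<close> the two branches meet with derivative 0 on both sides. For
  \<open>n = 0\<close> there would be a kink, the derivative jumping from 0 to 1.\<close>

lemma DERIV_cross_int:
  assumes "n > 0"
  shows "(cross_int n has_real_derivative exp t * max 0 t ^ n / fact n) (at t)"
proof -
  consider "t < 0" | "t = 0" | "t > 0" by linarith
  then show ?thesis
  proof cases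
    case 1
    have "((\<lambda>_. 0 :: real) has_real_derivative 0) (at t)" by simp
    moreover have "\<forall>\<^sub>F x in nhds t. cross_int n x = 0"
      using eventually_nhds_in_open[of "{..<0::real}" t] 1 by (auto elim!: eventually_mono)
    ultimately have "(cross_int n has_real_derivative 0) (at t)"
      by (subst DERIV_cong_ev[OF refl _ refl, where g = "\<lambda>_. 0"]) auto
    then show ?thesis using 1 assms by (simp add: max_def power_0_left)
  next
    case 2
    have "((\<lambda>x. (exp_poly_int n x - exp_poly_int n 0) / (x - 0)) \<longlongrightarrow> 0) (at 0)"
      using DERIV_exp_poly_int[of n 0] assms by (simp add: has_field_derivative_iff power_0_left)
    then have "((\<lambda>x. exp_poly_int n x / x) \<longlongrightarrow> 0) (at_right 0)"
      by (simp add: filterlim_at_split)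
    then have "((\<lambda>x. cross_int n x / x) \<longlongrightarrow> 0) (at_right 0)"
      by (rule tendsto_cong[THEN iffD1, rotated])
        (auto simp: eventually_at_right_field cross_int_def intro!: exI[of _ 1])
    moreover have "((\<lambda>x. cross_int n x / x) \<longlongrightarrow> 0) (at_left 0)"
      by (rule tendsto_eventually) (auto simp: eventually_at_left_field intro!: exI[of _ "-1"])
    ultimately have "((\<lambda>x. cross_int n x / x) \<longlongrightarrow> 0) (at 0)"
      by (simp add: filterlim_at_split)
    then show ?thesis using 2 assms by (simp add: has_field_derivative_iff power_0_left)
  next
    case 3
    have "\<forall>\<^sub>F x in nhds t. cross_int n x = exp_poly_int n x"
      using eventually_nhds_in_open[of "{0::real<..}" t] 3
      by (auto elim!: eventually_mono simp: cross_int_def)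
    then have "(cross_int n has_real_derivative exp t * t ^ n / fact n) (at t)"
      using DERIV_exp_poly_int[of n t] by (subst DERIV_cong_ev[OF refl _ refl]) auto
    then show ?thesis using 3 by simp
  qed
qed

text \<open>Both sides vanish at 0. With \<open>q = x + n\<close>, the difference has derivative
  \<open>exp x * x ^ n * n / (fact n * q\<^sup>2)\<close>, which is nonnegative. The lower bound
  below arises in the same way with \<open>q = x + n + 1\<close>, where the factor \<open>n\<close>
  turns into \<open>x\<close>.\<close>

lemma exp_poly_int_le:
  assumes "n > 0" "t \<ge> 0"
  shows "exp_poly_int n t \<le> exp t * t ^ Suc n / (fact n * (t + real n))"
proof -
  let ?F = "\<lambda>t. exp t * t ^ Suc n / (fact n * (t + real n)) - exp_poly_int n t"
  have "?F 0 \<le> ?F t"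
  proof (rule DERIV_nonneg_imp_nondecreasing[OF assms(2)], intro exI conjI)
    fix x :: real assume x: "0 \<le> x" "x \<le> t"
    define q where "q = x + real n"
    have q: "q > 0" using x assms(1) by (simp add: q_def)
    show "(?F has_real_derivative ((exp x * x ^ Suc n + exp x * (real (Suc n) * x ^ n)) * (fact n * q)
        - exp x * x ^ Suc n * fact n) / (fact n * q * (fact n * q)) - exp x * x ^ n / fact n) (at x)"
      using q by (auto intro!: derivative_eq_intros DERIV_exp_poly_int DERIV_power_Suc[where n = n and s = UNIV, OF DERIV_ident] simp: q_def simp del: power_Suc)
    have "((exp x * x ^ Suc n + exp x * (real (Suc n) * x ^ n)) * (fact n * q)
        - exp x * x ^ Suc n * fact n) / (fact n * q * (fact n * q)) - exp x * x ^ n / fact n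
      = exp x * x ^ n * ((x + real (Suc n)) * q - x - q\<^sup>2) / (fact n * q\<^sup>2)"
      using q by (simp add: divide_simps power2_eq_square) (simp add: algebra_simps)
    also have "(x + real (Suc n)) * q - x - q\<^sup>2 = real n"
      by (simp add: q_def power2_eq_square algebra_simps)
    also have "exp x * x ^ n * real n / (fact n * q\<^sup>2) \<ge> 0" using x by simp
    finally show "((exp x * x ^ Suc n + exp x * (real (Suc n) * x ^ n)) * (fact n * q)
        - exp x * x ^ Suc n * fact n) / (fact n * q * (fact n * q)) - exp x * x ^ n / fact n \<ge> 0" .
  qed
  then show ?thesis by simp
qed

lemma exp_poly_int_ge:
  assumes "t \<ge> 0"
  shows "exp_poly_int n t \<ge> exp t * t ^ Suc n / (fact n * (t + real (Suc n)))"
proof -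
  let ?F = "\<lambda>t. exp_poly_int n t - exp t * t ^ Suc n / (fact n * (t + real (Suc n)))"
  have "?F 0 \<le> ?F t"
  proof (rule DERIV_nonneg_imp_nondecreasing[OF assms], intro exI conjI)
    fix x :: real assume x: "0 \<le> x" "x \<le> t"
    define q where "q = x + real (Suc n)"
    have q: "q > 0" using x by (simp add: q_def)
    show "(?F has_real_derivative exp x * x ^ n / fact n -
        ((exp x * x ^ Suc n + exp x * (real (Suc n) * x ^ n)) * (fact n * q)
        - exp x * x ^ Suc n * fact n) / (fact n * q * (fact n * q))) (at x)"
      using q by (auto intro!: derivative_eq_intros DERIV_exp_poly_int DERIV_power_Suc[where n = n and s = UNIV, OF DERIV_ident] simp: q_def simp del: power_Suc)
    have "exp x * x ^ n / fact n -
        ((exp x * x ^ Suc n + exp x * (real (Suc n) * x ^ n)) * (fact n * q)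
        - exp x * x ^ Suc n * fact n) / (fact n * q * (fact n * q))
      = exp x * x ^ n * (q\<^sup>2 - ((x + real (Suc n)) * q - x)) / (fact n * q\<^sup>2)"
      using q by (simp add: divide_simps power2_eq_square) (simp add: algebra_simps)
    also have "q\<^sup>2 - ((x + real (Suc n)) * q - x) = x"
      by (simp add: q_def power2_eq_square algebra_simps)
    also have "exp x * x ^ n * x / (fact n * q\<^sup>2) \<ge> 0" using x by simp
    finally show "exp x * x ^ n / fact n -
        ((exp x * x ^ Suc n + exp x * (real (Suc n) * x ^ n)) * (fact n * q)
        - exp x * x ^ Suc n * fact n) / (fact n * q * (fact n * q)) \<ge> 0" .
  qed
  then show ?thesis by simp
qed

text \<open>The volume of the points with \<open>n + 1\<close> coordinates, all at least \<open>b\<close>, whose product is at most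
  \<open>T\<close>.\<close>
definition cross_vol :: "real \<Rightarrow> nat \<Rightarrow> real \<Rightarrow> real" where
  "cross_vol b n T = b ^ Suc n * cross_int n (ln (T / b ^ Suc n))"

text \<open>An antiderivative of the volume \<open>cross_vol b n (T / x)\<close> of the slice at height \<open>x\<close>.\<close>
definition cross_antideriv :: "real \<Rightarrow> nat \<Rightarrow> real \<Rightarrow> real \<Rightarrow> real" where
  "cross_antideriv b n T x = - (x * b ^ Suc n * cross_int (Suc n) (ln (T / (x * b ^ Suc n))))"

section \<open>Derivatives, monotonicity and convexity of the slice volumes\<close>

context
  fixes b T :: real
  assumes b: "b > 0" and T: "T > 0"
begin

lemma cross_vol_nonneg: "cross_vol b n T' \<ge> 0"
  using b cross_int_nonneg by (simp add: cross_vol_def)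

lemma cross_antideriv_self: "cross_antideriv b n T b = - cross_vol b (Suc n) T"
  by (simp add: cross_antideriv_def cross_vol_def)

lemma cross_antideriv_le_0: "x > 0 \<Longrightarrow> cross_antideriv b n T x \<le> 0"
  using b cross_int_nonneg by (simp add: cross_antideriv_def)

lemma cross_antideriv_eq_0:
  assumes "x > 0" "T \<le> b ^ Suc n * x"
  shows "cross_antideriv b n T x = 0"
proof -
  have "T / (x * b ^ Suc n) \<le> 1" using assms b by (simp add: field_simps)
  then have "ln (T / (x * b ^ Suc n)) \<le> 0" using assms b T by (subst ln_le_zero_iff) auto
  then show ?thesis by (simp add: cross_antideriv_def)
qed

lemma cross_vol_antimono:
  assumes "0 < x" "x \<le> y"
  shows "cross_vol b n (T / y) \<le> cross_vol b n (T / x)"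
proof -
  have "ln (T / y / b ^ Suc n) \<le> ln (T / x / b ^ Suc n)"
    using assms b T by (intro ln_mono divide_right_mono divide_left_mono) auto
  then show ?thesis unfolding cross_vol_def using b by (intro mult_left_mono cross_int_mono) auto
qed

lemma DERIV_ln_quotient:
  assumes "x > 0"
  shows "((\<lambda>x. ln (T / x / b ^ Suc n)) has_real_derivative - 1 / x) (at x)"
proof -
  have "((\<lambda>x. ln T - ln x - ln (b ^ Suc n)) has_real_derivative - 1 / x) (at x)"
    using assms by (auto intro!: derivative_eq_intros)
  moreover have "ln (T / y / b ^ Suc n) = ln T - ln y - ln (b ^ Suc n)" if "y > 0" for y
    using that b T by (simp add: ln_div ln_mult del: power_Suc)
  then have "\<forall>\<^sub>F y in nhds x. ln (T / y / b ^ Suc n) = ln T - ln y - ln (b ^ Suc n)"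
    using eventually_nhds_in_open[of "{0::real<..}" x] assms by (auto elim!: eventually_mono)
  ultimately show ?thesis by (subst DERIV_cong_ev[OF refl _ refl]) auto
qed

text \<open>The factor \<open>x\<close> and the logarithm, whose derivative is
  \<open>- 1 / x\<close>, contribute the two terms of the recursion \<open>cross_int_Suc\<close>;
  their difference is \<open>cross_int n\<close>.\<close>

lemma DERIV_cross_antideriv:
  assumes x: "x > 0"
  shows "(cross_antideriv b n T has_real_derivative cross_vol b n (T / x)) (at x)"
proof -
  define \<tau> where "\<tau> = ln (T / x / b ^ Suc n)"
  have "((\<lambda>x. - (x * b ^ Suc n * cross_int (Suc n) (ln (T / x / b ^ Suc n)))) has_real_derivative
      - (b ^ Suc n * cross_int (Suc n) \<tau> +
         exp \<tau> * max 0 \<tau> ^ Suc n / fact (Suc n) * (- 1 / x) * (x * b ^ Suc n))) (at x)"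
    unfolding \<tau>_def
    by (rule derivative_eq_intros DERIV_chain2[OF DERIV_cross_int] DERIV_ln_quotient[OF x] refl | simp)+
  also have "- (B * C + P * (- 1 / x) * (x * B)) = B * (P - C)" for B C P :: real
    using x by (simp add: algebra_simps)
  also have "exp \<tau> * max 0 \<tau> ^ Suc n / fact (Suc n) - cross_int (Suc n) \<tau> = cross_int n \<tau>"
    using cross_int_Suc[of n \<tau>] by simp
  finally show ?thesis by (simp add: cross_antideriv_def[abs_def] cross_vol_def \<tau>_def)
qed

text \<open>Eliminating the exponential displays the derivative as minus a product of two
  nonnegative nonincreasing functions of \<open>x\<close>. It is therefore nondecreasing, which is
  the convexity used for the midpoint rule.\<close>

lemma DERIV_cross_vol_quotient:
  assumes x: "x > 0" and n: "n > 0"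
  shows "((\<lambda>x. cross_vol b n (T / x)) has_real_derivative
      - (T / fact n * (max 0 (ln (T / x / b ^ Suc n)) ^ n * (1 / x\<^sup>2)))) (at x)"
proof -
  define \<tau> where "\<tau> = ln (T / x / b ^ Suc n)"
  have e: "exp \<tau> = T / x / b ^ Suc n" using x b T by (simp add: \<tau>_def)
  have "((\<lambda>x. b ^ Suc n * cross_int n (ln (T / x / b ^ Suc n))) has_real_derivative
      b ^ Suc n * (exp \<tau> * max 0 \<tau> ^ n / fact n * (- 1 / x))) (at x)"
    unfolding \<tau>_def
    by (rule derivative_eq_intros DERIV_chain2[OF DERIV_cross_int[OF n]] DERIV_ln_quotient[OF x] refl | simp)+
  also have "b ^ Suc n * (exp \<tau> * max 0 \<tau> ^ n / fact n * (- 1 / x)) = - (T / fact n * (max 0 \<tau> ^ n * (1 / x\<^sup>2)))"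
    unfolding e using b x by (simp add: field_simps power2_eq_square)
  finally show ?thesis by (simp add: cross_vol_def \<tau>_def)
qed

lemma cross_vol_le_increment:
  assumes "x > 0"
  shows "cross_vol b n (T / (x + 1)) \<le> cross_antideriv b n T (x + 1) - cross_antideriv b n T x"
    and "cross_antideriv b n T (x + 1) - cross_antideriv b n T x \<le> cross_vol b n (T / x)"
proof -
  obtain z where z: "x < z" "z < x + 1"
    "cross_antideriv b n T (x + 1) - cross_antideriv b n T x = (x + 1 - x) * cross_vol b n (T / z)"
    using MVT2[of x "x + 1" "cross_antideriv b n T" "\<lambda>z. cross_vol b n (T / z)"]
      DERIV_cross_antideriv assms by auto
  show "cross_vol b n (T / (x + 1)) \<le> cross_antideriv b n T (x + 1) - cross_antideriv b n T x"
    unfolding z(3) using cross_vol_antimono[of z "x + 1" n] z assms by simp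
  show "cross_antideriv b n T (x + 1) - cross_antideriv b n T x \<le> cross_vol b n (T / x)"
    unfolding z(3) using cross_vol_antimono[of x z n] z assms by simp
qed

lemma cross_vol_midpoint:
  assumes c: "c \<ge> b + 1/2" and n: "n > 0"
  shows "cross_vol b n (T / c) \<le> cross_antideriv b n T (c + 1/2) - cross_antideriv b n T (c - 1/2)"
proof -
  have "cross_vol b n (T / c) + 0 / 24 \<le> cross_antideriv b n T (c + 1/2) - cross_antideriv b n T (c - 1/2)"
  proof (rule midpoint_le_increment)
    fix x assume "x \<in> {c - 1/2..c + 1/2}"
    then have x: "x > 0" using c b by auto
    show "(cross_antideriv b n T has_real_derivative cross_vol b n (T / x)) (at x)"
      by (rule DERIV_cross_antideriv[OF x])
    show "((\<lambda>x. cross_vol b n (T / x)) has_real_derivative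
      - (T / fact n * (max 0 (ln (T / x / b ^ Suc n)) ^ n * (1 / x\<^sup>2)))) (at x)"
      by (rule DERIV_cross_vol_quotient[OF x n])
  next
    fix x y assume xy: "c - 1/2 \<le> x" "x \<le> y" "y \<le> c + 1/2"
    then have x: "x > 0" using c b by auto
    have "max 0 (ln (T / y / b ^ Suc n)) ^ n * (1 / y\<^sup>2) \<le> max 0 (ln (T / x / b ^ Suc n)) ^ n * (1 / x\<^sup>2)"
      using x xy b T
      by (intro mult_mono power_mono max.mono ln_mono divide_right_mono divide_left_mono) auto
    then have "T / fact n * (max 0 (ln (T / y / b ^ Suc n)) ^ n * (1 / y\<^sup>2))
        \<le> T / fact n * (max 0 (ln (T / x / b ^ Suc n)) ^ n * (1 / x\<^sup>2))"
      using T by (intro mult_left_mono) auto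
    then show "0 * (y - x) \<le> - (T / fact n * (max 0 (ln (T / y / b ^ Suc n)) ^ n * (1 / y\<^sup>2)))
        - - (T / fact n * (max 0 (ln (T / x / b ^ Suc n)) ^ n * (1 / x\<^sup>2)))"
      by linarith
  qed
  then show ?thesis by simp
qed

text \<open>On \<open>{b..b + 1}\<close> the logarithmic factor is at least its value at the right
  end, and the factor \<open>1 / x\<^sup>2\<close> falls at the rate of
  \<open>inverse_square_increment_ge\<close>. For fixed \<open>b\<close> and \<open>n\<close> the
  gain is of order \<open>T * (ln T) ^ n\<close>.\<close>

lemma cross_vol_midpoint_gain:
  assumes n: "n > 0"
  shows "cross_vol b n (T / (b + 1/2)) +
      T / fact n * (max 0 (ln (T / (b + 1) / b ^ Suc n)) ^ n * (2 * b / (b + 1) ^ 4)) / 24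
    \<le> cross_antideriv b n T (b + 1) - cross_antideriv b n T b"
proof -
  define m where "m = max 0 (ln (T / (b + 1) / b ^ Suc n)) ^ n"
  define M where "M = (\<lambda>x. max 0 (ln (T / x / b ^ Suc n)) ^ n)"
  define g where "g = (\<lambda>x. - (T / fact n * (M x * (1 / x\<^sup>2))))"
  have "cross_vol b n (T / (b + 1/2)) + T / fact n * (m * (2 * b / (b + 1) ^ 4)) / 24
    \<le> cross_antideriv b n T (b + 1/2 + 1/2) - cross_antideriv b n T (b + 1/2 - 1/2)"
  proof (rule midpoint_le_increment)
    fix x assume "x \<in> {b + 1/2 - 1/2..b + 1/2 + 1/2}"
    then have x: "x > 0" using b by auto
    show "(cross_antideriv b n T has_real_derivative cross_vol b n (T / x)) (at x)"
      by (rule DERIV_cross_antideriv[OF x])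
    show "((\<lambda>x. cross_vol b n (T / x)) has_real_derivative g x) (at x)"
      unfolding g_def M_def by (rule DERIV_cross_vol_quotient[OF x n])
  next
    fix x y assume "b + 1/2 - 1/2 \<le> x" "x \<le> y" "y \<le> b + 1/2 + 1/2"
    then have xy: "b \<le> x" "x \<le> y" "y \<le> b + 1" by auto
    have M: "M v \<le> M u" if "0 < u" "u \<le> v" for u v
      unfolding M_def using that b T
      by (intro power_mono max.mono ln_mono divide_right_mono divide_left_mono) auto
    have "m * (2 * b / (b + 1) ^ 4 * (y - x)) \<le> M y * (1 / x\<^sup>2 - 1 / y\<^sup>2)"
      using M[of y "b + 1"] b xy inverse_square_increment_ge[OF b xy]
      by (intro mult_mono) (auto simp: m_def M_def)
    also have "\<dots> \<le> M x * (1 / x\<^sup>2) - M y * (1 / y\<^sup>2)"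
      using M[of x y] b xy by (simp add: algebra_simps divide_right_mono)
    finally have "T / fact n * (m * (2 * b / (b + 1) ^ 4 * (y - x)))
        \<le> T / fact n * (M x * (1 / x\<^sup>2) - M y * (1 / y\<^sup>2))"
      using T by (intro mult_left_mono) auto
    then show "T / fact n * (m * (2 * b / (b + 1) ^ 4)) * (y - x) \<le> g y - g x"
      unfolding g_def by (simp only: right_diff_distrib mult.assoc)
  qed
  moreover have "b + 1/2 + 1/2 = b + 1" "b + 1/2 - 1/2 = b" by simp_all
  ultimately show ?thesis by (simp only: m_def)
qed

end

section \<open>Endpoint comparison in every dimension\<close>

theorem hyp_count_le_cross_vol:
  assumes a: "a > 1" and T: "T > 0"
  shows "real (hyp_count a (Suc n) T) \<le> cross_vol (a - 1) n T"
  using T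
proof (induction n arbitrary: T)
  case (0 T)
  \<comment> \<open>The shift from \<open>a\<close> to \<open>a - 1\<close> absorbs the rounding of
    the ceiling, which is less than 1.\<close>
  have "real (nat \<lceil>T - a\<rceil>) \<le> max 0 (T - (a - 1))" by linarith
  moreover have "cross_vol (a - 1) 0 T = max 0 (T - (a - 1))"
    using a 0 by (auto simp: cross_vol_def cross_int_def max_def field_simps)
  ultimately show ?case by (simp add: hyp_count_1)
next
  case (Suc n T)
  define b where "b = a - 1"
  have b: "b > 0" using a by (simp add: b_def)
  obtain M :: nat where "T / a ^ Suc n \<le> real M" using real_arch_simple by blast
  then have "T / a ^ Suc n \<le> a + real M" using a by simp
  then have M: "T \<le> a ^ Suc n * (a + real M)" using a by (simp add: pos_divide_le_eq mult.commute)
  have "real (hyp_count a (Suc (Suc n)) T) = (\<Sum>k<M. real (hyp_count a (Suc n) (T / (a + real k))))"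
    using hyp_count_Suc[OF _ M] a by simp
  also have "\<dots> \<le> (\<Sum>k<M. cross_vol b n (T / (a + real k)))"
    unfolding b_def using a Suc.prems by (intro sum_mono Suc.IH) auto
  \<comment> \<open>The sample point \<open>a + k\<close> is the right end of the unit interval
    starting at \<open>b + k\<close>, where the decreasing slice volume is smallest.\<close>
  also have "\<dots> \<le> cross_antideriv b n T (b + real M) - cross_antideriv b n T b"
    using cross_vol_le_increment(1)[OF b Suc.prems, of "b + real k" n for k] b
    by (intro sum_increments_ge) (auto simp: b_def algebra_simps)
  also have "\<dots> \<le> cross_vol b (Suc n) T"
    using cross_antideriv_self[OF b Suc.prems] cross_antideriv_le_0[OF b Suc.prems, of "b + real M" n] b
    by simp
  finally show ?case by (simp add: b_def)
qed

theorem hyp_count_ge_cross_vol: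
  assumes a: "a > 0" and T: "T > 0"
  shows "cross_vol a n T \<le> real (hyp_count a (Suc n) T)"
  using T
proof (induction n arbitrary: T)
  case (0 T)
  have "max 0 (T - a) \<le> real (nat \<lceil>T - a\<rceil>)" by linarith
  moreover have "cross_vol a 0 T = max 0 (T - a)"
    using a 0 by (auto simp: cross_vol_def cross_int_def max_def field_simps)
  ultimately show ?case by (simp add: hyp_count_1)
next
  case (Suc n T)
  obtain M :: nat where "T / a ^ Suc n \<le> real M" using real_arch_simple by blast
  then have "T / a ^ Suc n \<le> a + real M" using a by simp
  then have M: "T \<le> a ^ Suc n * (a + real M)" using a by (simp add: pos_divide_le_eq mult.commute)
  \<comment> \<open>The same \<open>M\<close> that exhausts the slices makes the antiderivative
    vanish at \<open>a + M\<close>, so the integral over \<open>{a..a + M}\<close> is the whole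
    volume.\<close>
  have "cross_vol a (Suc n) T = cross_antideriv a n T (a + real M) - cross_antideriv a n T a"
    using cross_antideriv_self[OF a Suc.prems] cross_antideriv_eq_0[OF a Suc.prems _ M] a by simp
  also have "\<dots> = (\<Sum>k<M. cross_antideriv a n T (a + real (Suc k)) - cross_antideriv a n T (a + real k))"
    by (subst sum_lessThan_telescope[of "\<lambda>k. cross_antideriv a n T (a + real k)"]) simp
  also have "\<dots> \<le> (\<Sum>k<M. cross_vol a n (T / (a + real k)))"
    using cross_vol_le_increment(2)[OF a Suc.prems, of "a + real k" n for k] a
    by (intro sum_mono) (auto simp: algebra_simps)
  also have "\<dots> \<le> (\<Sum>k<M. real (hyp_count a (Suc n) (T / (a + real k))))"
    using a Suc.prems by (intro sum_mono Suc.IH) auto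
  also have "\<dots> = real (hyp_count a (Suc (Suc n)) T)"
    using hyp_count_Suc[OF _ M] a by simp
  finally show ?case .
qed

section \<open>Midpoint comparison, starting with two coordinates\<close>

lemma sum_inverse_le_ln:
  assumes b: "b > 0" and p: "p > 0"
  shows "(\<Sum>k<p. 1 / (b + 1/2 + real k)) + 2 * b / (b + 1) ^ 4 / 24 \<le> ln (b + real p) - ln b"
proof -
  have mid: "1 / c + \<kappa> / 24 \<le> ln (c + 1/2) - ln (c - 1/2)"
    if "c \<ge> b + 1/2" and \<kappa>: "\<And>x y. c - 1/2 \<le> x \<Longrightarrow> x \<le> y \<Longrightarrow> y \<le> c + 1/2 \<Longrightarrow> \<kappa> * (y - x) \<le> 1 / x\<^sup>2 - 1 / y\<^sup>2"
    for c \<kappa> :: real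
    using that b
    by (intro midpoint_le_increment[where h = "\<lambda>x. 1 / x" and g = "\<lambda>x. - (1 / x\<^sup>2)"])
      (auto intro!: derivative_eq_intros simp: power2_eq_square)
  \<comment> \<open>The convexity of \<open>1 / x\<close> is used quantitatively on the first
    interval only. This constant gain, multiplied by \<open>T\<close>, later outweighs all errors of
    order \<open>sqrt T\<close>.\<close>
  have first: "1 / (b + 1/2) + 2 * b / (b + 1) ^ 4 / 24 \<le> ln (b + 1/2 + 1/2) - ln (b + 1/2 - 1/2)"
    by (rule mid) (use inverse_square_increment_ge[OF b] in auto)
  obtain q where q: "p = Suc q" using p by (cases p) auto
  have "(\<Sum>k<q. 1 / (b + 1 + 1/2 + real k)) \<le> ln (b + 1 + real q) - ln (b + 1)"
  proof (rule sum_increments_ge)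
    fix k
    have "1 / (b + 1 + 1/2 + real k) + 0 / 24 \<le> ln (b + 1 + 1/2 + real k + 1/2) - ln (b + 1 + 1/2 + real k - 1/2)"
      using b by (intro mid) (auto simp: frac_le power_mono)
    then show "1 / (b + 1 + 1/2 + real k) \<le> ln (b + 1 + real (Suc k)) - ln (b + 1 + real k)"
      by (simp add: algebra_simps)
  qed
  then show ?thesis using first unfolding q sum.lessThan_Suc_shift by (simp add: algebra_simps)
qed

text \<open>Dirichlet's hyperbola method: a pair with product below \<open>X\<^sup>2\<close> has an entry below \<open>X\<close>.\<close>
lemma hyp_count_2:
  assumes a: "a > 0" and X: "X > 0"
  defines "p \<equiv> nat \<lceil>X - a\<rceil>"
  shows "hyp_count a 2 (X\<^sup>2) + p\<^sup>2 = 2 * (\<Sum>k<p. hyp_count a 1 (X\<^sup>2 / (a + real k)))"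
proof -
  define S where "S = {(k, l). (a + real k) * (a + real l) < X\<^sup>2}"
  define S1 where "S1 = Sigma {..<p} (\<lambda>k. {l. a + real l < X\<^sup>2 / (a + real k)})"
  have p: "k < p \<longleftrightarrow> a + real k < X" for k
    by (simp add: p_def add_less_iff_nat_ceiling)
  have fin: "finite S1" unfolding S1_def add_less_iff_nat_ceiling by auto
  have S1: "S1 = {(k, l). k < p \<and> (a + real k) * (a + real l) < X\<^sup>2}"
    using a by (auto simp: S1_def pos_less_divide_eq mult.commute)
  have "hyp_cross a 2 (X\<^sup>2) = (\<lambda>(k, l). [k, l]) ` S"
    by (auto simp: hyp_cross_def S_def numeral_2_eq_2 length_Suc_conv image_iff)
  then have "hyp_count a 2 (X\<^sup>2) = card S"
    by (simp add: hyp_count_def card_image inj_on_def split_def prod_eq_iff)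
  \<comment> \<open>Inclusion and exclusion for \<open>S1\<close> and its mirror image. Their
    intersection is the full square of pairs with both entries below \<open>p\<close>, which
    accounts for \<open>p\<^sup>2\<close>.\<close>
  moreover have "S = S1 \<union> prod.swap ` S1"
  proof (intro set_eqI iffI)
    fix z assume z: "z \<in> S"
    obtain k l where kl: "z = (k, l)" by (cases z)
    have "k < p \<or> l < p"
    proof (rule ccontr)
      assume "\<not> ?thesis"
      then have "X \<le> a + real k" "X \<le> a + real l" by (auto simp: p not_less)
      then have "X * X \<le> (a + real k) * (a + real l)" using X by (intro mult_mono) auto
      then show False using z by (simp add: S_def kl power2_eq_square)
    qed
    then show "z \<in> S1 \<union> prod.swap ` S1"
      using z by (auto simp: S_def S1 kl image_iff mult.commute)
  qed (auto simp: S_def S1 mult.commute)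
  moreover have "S1 \<inter> prod.swap ` S1 = {..<p} \<times> {..<p}"
  proof -
    have "(a + real k) * (a + real l) < X\<^sup>2" if "k < p" "l < p" for k l
      using that a X unfolding p power2_eq_square by (intro mult_strict_mono) auto
    then show ?thesis by (auto simp: S1 image_iff mult.commute)
  qed
  moreover have "card (prod.swap ` S1) = card S1" by (simp add: card_image)
  ultimately have "hyp_count a 2 (X\<^sup>2) + p\<^sup>2 = 2 * card S1"
    using card_Un_Int[of S1 "prod.swap ` S1"] fin by (simp add: power2_eq_square card_cartesian_product)
  also have "card S1 = (\<Sum>k<p. hyp_count a 1 (X\<^sup>2 / (a + real k)))"
    unfolding S1_def using fin
    by (subst card_SigmaI) (auto simp: hyp_count_1 add_less_iff_nat_ceiling)
  finally show ?thesis .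
qed

text \<open>In one coordinate the count can exceed the volume by a rounding error. The hyperbola
  method sums such errors over about \<open>sqrt T\<close> slices only, so they stay below the gain
  \<open>2 * \<delta> * T\<close>.\<close>

lemma hyp_count_2_le_cross_vol:
  assumes b: "b > 0"
  shows "\<forall>\<^sub>F T in at_top. real (hyp_count (b + 1/2) 2 T) \<le> cross_vol b 1 T"
proof -
  define a where "a = b + 1/2"
  have a: "a > 0" using b by (simp add: a_def)
  define \<delta> where "\<delta> = 2 * b / (b + 1) ^ 4 / 24"
  have \<delta>: "\<delta> > 0" using b by (simp add: \<delta>_def)
  \<comment> \<open>The first entry gives \<open>p > 0\<close>. The other two give
    \<open>(2 + 2 * a) * X + 1 \<le> 2 * \<delta> * X\<^sup>2\<close>, the inequality that remains
    at the end.\<close>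
  define X0 where "X0 = max (a + 1) (max 1 ((3 + 2 * a) / (2 * \<delta>)))"
  have "real (hyp_count a 2 T) \<le> cross_vol b 1 T" if T: "T \<ge> X0\<^sup>2" for T
  proof -
    define X where "X = sqrt T"
    have "X0 \<ge> 1" by (simp add: X0_def)
    then have "T > 0" using T by (smt (verit) one_le_power)
    then have TX: "T = X\<^sup>2" and "X \<ge> X0" using T \<open>X0 \<ge> 1\<close> by (auto simp: X_def intro: real_le_rsqrt)
    then have X: "X > a" "X \<ge> 1" "2 * \<delta> * X \<ge> 3 + 2 * a"
      using \<delta> by (auto simp: X0_def field_simps)
    define p where "p = nat \<lceil>X - a\<rceil>"
    have p: "X - a \<le> real p" "real p < X - a + 1" "p > 0" using X by (auto simp: p_def) linarith+
    have "real (hyp_count a 1 (T / (a + real k))) \<le> T * (1 / (a + real k)) + (1 - a)" if "k < p" for k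
    proof -
      have k: "a + real k < X" using that by (simp add: p_def add_less_iff_nat_ceiling)
      then have "X * (a + real k) \<le> X * X" using X by (intro mult_left_mono) auto
      then have "X \<le> T / (a + real k)" using a by (simp add: TX power2_eq_square pos_le_divide_eq)
      \<comment> \<open>Without this the truncation of \<open>nat\<close> at 0 could violate the
        linear bound that follows.\<close>
      then have "a \<le> T / (a + real k)" using X by simp
      then have "real (nat \<lceil>T / (a + real k) - a\<rceil>) \<le> T / (a + real k) + (1 - a)" by linarith
      then show ?thesis by (simp add: hyp_count_1)
    qed
    then have "(\<Sum>k<p. real (hyp_count a 1 (T / (a + real k)))) \<le> (\<Sum>k<p. T * (1 / (a + real k)) + (1 - a))"
      by (intro sum_mono) auto
    also have "\<dots> = T * (\<Sum>k<p. 1 / (b + 1/2 + real k)) + real p * (1 - a)"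
      by (simp add: sum.distrib sum_distrib_left a_def)
    also have "\<dots> \<le> T * (ln (b + real p) - ln b - \<delta>) + real p * (1 / 2)"
      using sum_inverse_le_ln[OF b p(3)] \<open>T > 0\<close> b
      by (intro add_mono mult_left_mono) (auto simp: \<delta>_def a_def)
    also have "\<dots> \<le> T * (ln X + 1 / (2 * X) - ln b - \<delta>) + (X + 1) * (1 / 2)"
    proof -
      \<comment> \<open>From \<open>p < X - a + 1\<close> and \<open>a = b + 1/2\<close>. The excess
        \<open>1/2\<close> over \<open>X\<close> costs only
        \<open>T / (2 * X) = X / 2\<close>.\<close>
      have "ln (b + real p) \<le> ln (X + 1/2)" using p b by (intro ln_mono) (auto simp: a_def)
      also have "X + 1/2 = X * (1 + 1 / (2 * X))" using X by (simp add: field_simps)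
      also have "ln \<dots> = ln X + ln (1 + 1 / (2 * X))"
      proof -
        have "1 + 1 / (2 * X) > 0" using X by (intro add_pos_pos) auto
        then show ?thesis using X by (intro ln_mult_pos) (auto intro: add_pos_pos)
      qed
      also have "ln (1 + 1 / (2 * X)) \<le> 1 / (2 * X)" using X by (intro ln_add_one_self_le_self) auto
      finally show ?thesis using \<open>T > 0\<close> p a by (intro add_mono mult_left_mono mult_right_mono) auto
    qed
    also have "\<dots> = T * (ln X - ln b - \<delta>) + X + 1 / 2"
    proof -
      have "T * (1 / (2 * X)) = X / 2" using X by (simp add: TX power2_eq_square)
      moreover have "X / 2 + (X + 1) * (1 / 2) = X + 1 / 2" by (simp add: field_simps)
      ultimately show ?thesis by (simp add: algebra_simps)
    qed
    finally have sum_le: "(\<Sum>k<p. real (hyp_count a 1 (T / (a + real k))))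
      \<le> T * (ln X - ln b - \<delta>) + X + 1 / 2" .
    have "real (hyp_count a 2 T) + (real p)\<^sup>2 = 2 * (\<Sum>k<p. real (hyp_count a 1 (T / (a + real k))))"
      using arg_cong[OF hyp_count_2[of a X], of real] a X unfolding TX p_def by simp
    moreover have "(X - a)\<^sup>2 \<le> (real p)\<^sup>2" using p X by (intro power_mono) auto
    ultimately have "real (hyp_count a 2 T) \<le> 2 * T * (ln X - ln b) - 2 * \<delta> * T + 2 * X + 1 - (X - a)\<^sup>2"
      using sum_le by (simp add: algebra_simps)
    also have "\<dots> \<le> 2 * T * (ln X - ln b) - T + b\<^sup>2"
    proof -
      have "(3 + 2 * a) * X \<le> 2 * \<delta> * X * X" using X by (intro mult_right_mono) auto
      then show ?thesis
        using X by (simp add: TX power2_diff power2_eq_square algebra_simps) (smt (verit) zero_le_square)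
    qed
    also have "\<dots> = cross_vol b 1 T"
    proof -
      define \<tau> where "\<tau> = 2 * (ln X - ln b)"
      have \<tau>: "ln (T / b ^ Suc 1) = \<tau>"
        using X b a by (simp add: TX \<tau>_def ln_div ln_realpow ln_mult flip: power2_eq_square)
      have "\<tau> \<ge> 0" using X b by (auto simp: a_def \<tau>_def intro!: ln_mono)
      have e: "b\<^sup>2 * exp \<tau> = T"
        using b \<open>T > 0\<close> by (simp flip: \<tau> add: power2_eq_square)
      have "cross_vol b 1 T = b\<^sup>2 * exp \<tau> * \<tau> - b\<^sup>2 * exp \<tau> + b\<^sup>2"
        unfolding cross_vol_def \<tau> using \<open>\<tau> \<ge> 0\<close>
        by (simp add: cross_int_def max_absorb2 power2_eq_square algebra_simps)
      then show ?thesis unfolding e by (simp add: \<tau>_def)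
    qed
    finally show ?thesis .
  qed
  then show ?thesis unfolding a_def eventually_at_top_linorder by blast
qed

text \<open>For large \<open>k\<close> the argument \<open>T / (a + k)\<close> drops below the
  threshold \<open>T0\<close> of the induction hypothesis, and monotonicity bounds the slice count
  by a constant \<open>C\<close>. As there are at most \<open>T / a ^ Suc n + 1\<close> slices, the
  loss is of order \<open>T\<close>, less than the gain on the first interval.\<close>

theorem hyp_count_le_cross_vol_midpoint:
  assumes b: "b > 0" and n: "n > 0"
  shows "\<forall>\<^sub>F T in at_top. real (hyp_count (b + 1/2) (Suc n) T) \<le> cross_vol b n T"
  using n
proof (induction n rule: nat_induct_non_zero)
  case 1
  show ?case using hyp_count_2_le_cross_vol[OF b] by (simp add: numeral_2_eq_2)
next
  case (Suc n)
  define a where "a = b + 1/2"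
  have a: "a > 0" using b by (simp add: a_def)
  obtain T0 where T0: "\<And>T. T \<ge> T0 \<Longrightarrow> real (hyp_count a (Suc n) T) \<le> cross_vol b n T"
    using Suc.IH unfolding eventually_at_top_linorder a_def by blast
  define C where "C = real (hyp_count a (Suc n) T0)"
  \<comment> \<open>Chosen so that \<open>m \<ge> K\<close> makes the gain at least
    \<open>C * (T / a ^ Suc n + T)\<close>, which covers \<open>C * M\<close> once
    \<open>T \<ge> 1\<close>.\<close>
  define K where "K = C * (1 / a ^ Suc n + 1) * 24 * fact n / (2 * b / (b + 1) ^ 4)"
  \<comment> \<open>With the logarithm at least 1, its \<open>n\<close>-th power is at least the
    logarithm itself and hence at least \<open>K\<close>.\<close>
  have "max 1 K \<le> ln (T / (b + 1) / b ^ Suc n)" if T: "T \<ge> exp (max 1 K) * ((b + 1) * b ^ Suc n)" for T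
  proof -
    have pos: "(b + 1) * b ^ Suc n > 0" using b by simp
    then have "exp (max 1 K) \<le> T / ((b + 1) * b ^ Suc n)"
      using T by (subst pos_le_divide_eq) auto
    moreover from this have "0 < T / ((b + 1) * b ^ Suc n)" using exp_gt_zero less_le_trans by blast
    ultimately show ?thesis unfolding divide_divide_eq_left by (subst ln_ge_iff) auto
  qed
  then have "\<forall>\<^sub>F T in at_top. max 1 K \<le> ln (T / (b + 1) / b ^ Suc n)"
    unfolding eventually_at_top_linorder by blast
  then show ?case
    unfolding a_def[symmetric] using eventually_ge_at_top[of 1]
  proof eventually_elim
    case (elim T)
    have T: "T > 0" using elim by simp
    define M where "M = nat \<lceil>T / a ^ Suc n\<rceil>"
    have "T / a ^ Suc n > 0" using T a by simp
    then have M: "T / a ^ Suc n \<le> real M" "real M \<le> T / a ^ Suc n + 1" "M > 0"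
      unfolding M_def by linarith+
    obtain q where q: "M = Suc q" using M(3) by (cases M) auto
    have "T / a ^ Suc n \<le> a + real M" using M(1) a by simp
    then have TM: "T \<le> a ^ Suc n * (a + real M)" using a by (simp add: pos_divide_le_eq mult.commute)
    define m where "m = max 0 (ln (T / (b + 1) / b ^ Suc n)) ^ n"
    define gain where "gain = T / fact n * (m * (2 * b / (b + 1) ^ 4)) / 24"
    have "K \<le> m"
    proof -
      have "K \<le> ln (T / (b + 1) / b ^ Suc n) ^ 1" using elim by simp
      also have "\<dots> \<le> ln (T / (b + 1) / b ^ Suc n) ^ n"
        using elim Suc.hyps by (intro power_increasing) auto
      also have "\<dots> = m" using elim by (simp add: m_def max_absorb2 del: power_Suc)
      finally show ?thesis .
    qed
    then have "T / fact n * (K * (2 * b / (b + 1) ^ 4)) / 24 \<le> gain"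
      unfolding gain_def using T b by (intro divide_right_mono mult_left_mono mult_right_mono) auto
    also have "K * (2 * b / (b + 1) ^ 4) = C * (1 / a ^ Suc n + 1) * 24 * fact n"
      using b by (simp add: K_def)
    also have "T / fact n * (C * (1 / a ^ Suc n + 1) * 24 * fact n) / 24 = C * (T / a ^ Suc n + T)"
      by (simp add: distrib_left)
    finally have gain: "C * (T / a ^ Suc n + T) \<le> gain" .
    have step: "real (hyp_count a (Suc n) (T / (a + real k))) \<le> cross_vol b n (T / (a + real k)) + C" for k
    proof (cases "T / (a + real k) \<ge> T0")
      case True
      then show ?thesis using T0[OF True] by (simp add: C_def)
    next
      case False
      then have "real (hyp_count a (Suc n) (T / (a + real k))) \<le> C"
        using hyp_count_mono[OF a] by (simp add: C_def)
      then show ?thesis using cross_vol_nonneg[OF b T, of n "T / (a + real k)"] by simp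
    qed
    have "real (hyp_count a (Suc (Suc n)) T) = (\<Sum>k<M. real (hyp_count a (Suc n) (T / (a + real k))))"
      using hyp_count_Suc[OF a TM] by simp
    also have "\<dots> \<le> (\<Sum>k<M. cross_vol b n (T / (a + real k)) + C)"
      by (intro sum_mono step)
    \<comment> \<open>The slice \<open>k = 0\<close>, sampled at the midpoint of
      \<open>{b..b + 1}\<close>, is split off because only there the gain is kept.\<close>
    also have "\<dots> = cross_vol b n (T / a) + (\<Sum>k<q. cross_vol b n (T / (a + 1 + real k))) + C * real M"
      unfolding q by (subst sum.distrib, subst sum.lessThan_Suc_shift) (simp add: algebra_simps)
    also have "(\<Sum>k<q. cross_vol b n (T / (a + 1 + real k)))
        \<le> cross_antideriv b n T (b + 1 + real q) - cross_antideriv b n T (b + 1)"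
    proof (rule sum_increments_ge)
      fix k
      show "cross_vol b n (T / (a + 1 + real k)) \<le> cross_antideriv b n T (b + 1 + real (Suc k))
          - cross_antideriv b n T (b + 1 + real k)"
        using cross_vol_midpoint[OF b T, of "a + 1 + real k" n] Suc.hyps by (simp add: a_def algebra_simps)
    qed
    also have "cross_vol b n (T / a) \<le> cross_antideriv b n T (b + 1) - cross_antideriv b n T b - gain"
      using cross_vol_midpoint_gain[OF b T Suc.hyps(1)] by (simp add: a_def gain_def m_def del: power_Suc)
    also have "C * real M \<le> gain"
    proof -
      have "real M \<le> T / a ^ Suc n + T" using M elim by simp
      then have "C * real M \<le> C * (T / a ^ Suc n + T)" by (intro mult_left_mono) (auto simp: C_def)
      then show ?thesis using gain by simp
    qed
    also have "cross_antideriv b n T (b + 1) - cross_antideriv b n T b - gain +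
        (cross_antideriv b n T (b + 1 + real q) - cross_antideriv b n T (b + 1)) + gain
      \<le> cross_vol b (Suc n) T"
      using cross_antideriv_self[OF b T] cross_antideriv_le_0[OF b T, of "b + 1 + real q" n] b by simp
    finally show ?case by simp
  qed
qed

section \<open>Closed bounds for the volumes\<close>

lemma cross_vol_bounds:
  assumes b: "b > 0" and T: "T \<ge> b ^ Suc n"
  defines "t \<equiv> ln T - real (Suc n) * ln b"
  shows "n > 0 \<Longrightarrow> cross_vol b n T \<le> T * t ^ Suc n / (fact n * (t + real n))"
    and "T * t ^ Suc n / (fact n * (t + real (Suc n))) \<le> cross_vol b n T"
proof -
  have pos: "b ^ Suc n > 0" "T > 0" using b T zero_less_power[OF b, of "Suc n"] by linarith+
  have t: "ln (T / b ^ Suc n) = t"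
    unfolding t_def by (simp only: ln_divide_pos[OF pos(2,1)] ln_realpow)
  \<comment> \<open>The hypothesis \<open>T \<ge> b ^ Suc n\<close> keeps the logarithm out of the
    range where \<open>cross_int\<close> is cut off.\<close>
  have "t \<ge> 0" unfolding t[symmetric] using pos T by simp
  have e: "b ^ Suc n * exp t = T" unfolding t[symmetric] using pos b by simp
  have vol: "cross_vol b n T = b ^ Suc n * exp_poly_int n t"
    unfolding cross_vol_def t using \<open>t \<ge> 0\<close> by (simp add: cross_int_def max_absorb2)
  show "cross_vol b n T \<le> T * t ^ Suc n / (fact n * (t + real n))" if "n > 0"
    using mult_left_mono[OF exp_poly_int_le[OF that \<open>t \<ge> 0\<close>], of "b ^ Suc n"] pos
    unfolding vol times_divide_eq_right mult.assoc[symmetric] e by simp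
  show "T * t ^ Suc n / (fact n * (t + real (Suc n))) \<le> cross_vol b n T"
    using mult_left_mono[OF exp_poly_int_ge[OF \<open>t \<ge> 0\<close>], of "b ^ Suc n" n] pos
    unfolding vol times_divide_eq_right mult.assoc[symmetric] e by simp
qed

section \<open>The approximation number as a counting function\<close>

text \<open>An enumeration \<open>e\<close> of the finite index type turns vectors into lists of
  length \<open>CARD('s)\<close> with the same product.\<close>

lemma
  fixes a T :: real
  assumes a: "a > 0"
  shows finite_lam_less: "finite {k :: nat ^ 's::finite. lam a k < T}"
    and card_lam_less: "card {k :: nat ^ 's::finite. lam a k < T} = hyp_count a CARD('s) T"
proof -
  obtain e where e: "bij_betw e {0..<CARD('s)} (UNIV :: 's set)"
    using ex_bij_betw_nat_finite[of "UNIV :: 's set"] by auto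
  define F where "F = (\<lambda>k :: nat ^ 's. map (\<lambda>i. k $ e i) [0..<CARD('s)])"
  have inj: "inj_on F A" for A
  proof (rule inj_onI)
    fix k l assume "F k = F l"
    then have eq: "k $ e i = l $ e i" if "i < CARD('s)" for i using that by (auto simp: F_def)
    have "k $ j = l $ j" for j
    proof -
      have "j \<in> e ` {0..<CARD('s)}" using e by (simp add: bij_betw_def)
      then obtain i where "i < CARD('s)" "j = e i" by auto
      then show ?thesis using eq by simp
    qed
    then show "k = l" by (simp add: vec_eq_iff)
  qed
  have len: "length (F k) = CARD('s)" for k by (simp add: F_def)
  have prod: "(\<Prod>m\<leftarrow>F k. a + real m) = lam a k" for k
  proof -
    have "(\<Prod>m\<leftarrow>F k. a + real m) = (\<Prod>i\<in>{0..<CARD('s)}. a + real (k $ e i))"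
      by (simp add: F_def o_def prod.list_conv_set_nth atLeast0LessThan)
    also have "\<dots> = lam a k"
      unfolding lam_def using prod.reindex_bij_betw[OF e, of "\<lambda>j. a + real (k $ j)"] by simp
    finally show ?thesis .
  qed
  have "F ` {k. lam a k < T} = hyp_cross a CARD('s) T"
  proof (intro set_eqI iffI)
    fix ks assume ks: "ks \<in> hyp_cross a CARD('s) T"
    define k where "k = (\<chi> j. ks ! inv_into {0..<CARD('s)} e j)"
    have "F k = ks"
      using ks e by (intro nth_equalityI) (auto simp: F_def hyp_cross_def k_def bij_betw_def inv_into_f_f)
    then have "k \<in> {k. lam a k < T}" using ks prod[of k] by (simp add: hyp_cross_def)
    then show "ks \<in> F ` {k. lam a k < T}" using \<open>F k = ks\<close> by blast
  qed (auto simp: hyp_cross_def prod len)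
  then have F: "bij_betw F {k. lam a k < T} (hyp_cross a CARD('s) T)"
    using inj by (simp add: bij_betw_def)
  show "finite {k :: nat ^ 's. lam a k < T}"
    using bij_betw_finite[OF F] finite_hyp_cross[OF a] by simp
  show "card {k :: nat ^ 's. lam a k < T} = hyp_count a CARD('s) T"
    using bij_betw_same_card[OF F] by (simp add: hyp_count_def)
qed

lemma n_eps_U_ball:
  assumes ab: "\<alpha> > -1" "\<beta> > -1" and a: "a > 0" and r: "r > 0" and T: "T > 0"
  shows "n_eps (norm_w \<alpha> \<beta>) (U_ball r a \<alpha> \<beta> :: (real ^ 's::finite \<Rightarrow> real) set) (L2 \<alpha> \<beta>) (T powr (- r))
    = enat (hyp_count a CARD('s) T)"
proof -
  interpret orthonormal_family "L2 \<alpha> \<beta>" "inner_w \<alpha> \<beta>" "jacobi_prod \<alpha> \<beta> :: nat ^ 's \<Rightarrow> _"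
    by (rule orthonormal_family_jacobi[OF ab])
  have lam: "lam a k > 0" for k :: "nat ^ 's"
    using a by (auto simp: lam_def intro!: prod_pos add_pos_nonneg)
  have norm: "(\<lambda>f :: real ^ 's \<Rightarrow> real. sqrt (inner_w \<alpha> \<beta> f f)) = norm_w \<alpha> \<beta>"
    by (rule ext) (simp add: norm_w_def)
  have ball: "{f \<in> L2 \<alpha> \<beta>. (\<lambda>k :: nat ^ 's. lam a k powr (2 * r) * \<bar>inner_w \<alpha> \<beta> f (jacobi_prod \<alpha> \<beta> k)\<bar>\<^sup>2) summable_on UNIV \<and>
      sqrt (\<Sum>\<^sub>\<infinity>k. lam a k powr (2 * r) * \<bar>inner_w \<alpha> \<beta> f (jacobi_prod \<alpha> \<beta> k)\<bar>\<^sup>2) \<le> 1} = U_ball r a \<alpha> \<beta>"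
    by (auto simp: U_ball_def K_space_def K_norm_def jacobi_coeff_def)
  show ?thesis
    using n_eps_weighted_ball[OF jacobi_prod_dense[OF ab] lam finite_lam_less[OF a] r T]
    unfolding norm ball card_lam_less[OF a] .
qed

theorem theorem6p10:
  fixes r :: real
  defines "n \<equiv> (\<lambda>a \<alpha> \<beta> \<epsilon>. ereal_of_enat
      (n_eps (norm_w \<alpha> \<beta>) (U_ball r a \<alpha> \<beta> :: (real ^ 's \<Rightarrow> real) set) (L2 \<alpha> \<beta>) \<epsilon>))"
    and "s \<equiv> CARD('s::finite)"
  assumes "r > 0" and "s \<ge> 2"
  shows
    "(\<forall>a > 1/2. \<exists>\<epsilon>' \<in> {0<..1}. \<forall>\<alpha> > -1. \<forall>\<beta> > -1. a = (\<alpha> + \<beta> + 1) / 2 \<longrightarrow> (\<forall>\<epsilon> \<in> {0<..\<epsilon>'}.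
        n a \<alpha> \<beta> \<epsilon> \<le> ereal (\<epsilon> powr (-1/r) * (ln (\<epsilon> powr (-1/r)) - s * ln (a - 1/2)) ^ s /
          (fact (s - 1) * (ln (\<epsilon> powr (-1/r)) + s * (1 - ln (a - 1/2)) - 1)))))
     \<and> (\<forall>a > 1. \<forall>\<alpha> > -1. \<forall>\<beta> > -1. a = (\<alpha> + \<beta> + 1) / 2 \<longrightarrow> (\<forall>\<epsilon> \<in> {0<..<(a - 1) powr (- s * r)}.
        n a \<alpha> \<beta> \<epsilon> \<le> ereal (\<epsilon> powr (-1/r) * (ln (\<epsilon> powr (-1/r)) - s * ln (a - 1)) ^ s /
          (fact (s - 1) * (ln (\<epsilon> powr (-1/r)) + s * (1 - ln (a - 1)) - 1)))))
     \<and> (\<forall>a > 0. \<forall>\<alpha> > -1. \<forall>\<beta> > -1. a = (\<alpha> + \<beta> + 1) / 2 \<longrightarrow> (\<forall>\<epsilon> \<in> {0<..<a powr (- s * r)}.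
        n a \<alpha> \<beta> \<epsilon> \<ge> ereal (\<epsilon> powr (-1/r) * (ln (\<epsilon> powr (-1/r)) - s * ln a) ^ s /
          (fact (s - 1) * (ln (\<epsilon> powr (-1/r)) + s * (1 - ln a))) - 1)))"
proof -
  obtain m where s: "s = Suc m" and m: "m > 0" using \<open>s \<ge> 2\<close> by (cases s) auto
  note r = \<open>r > 0\<close>
  have n_eq: "n a \<alpha> \<beta> \<epsilon> = ereal (real (hyp_count a (Suc m) (\<epsilon> powr (-1/r))))"
    if "\<alpha> > -1" "\<beta> > -1" "a > 0" "\<epsilon> > 0" for a \<alpha> \<beta> \<epsilon>
  proof -
    have "(\<epsilon> powr (-1/r)) powr (- r) = \<epsilon>" using r \<open>\<epsilon> > 0\<close> by (simp add: powr_powr)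
    then show ?thesis
      using n_eps_U_ball[OF that(1-3) r, of "\<epsilon> powr (-1/r)", where 's = 's] \<open>\<epsilon> > 0\<close>
      by (simp add: n_def flip: s s_def)
  qed
  \<comment> \<open>In terms of \<open>T\<close>, the open range of \<open>\<epsilon>\<close> says
    that \<open>T\<close> exceeds \<open>b ^ s\<close>, so \<open>cross_vol_bounds\<close>
    applies.\<close>
  have large: "b ^ Suc m < \<epsilon> powr (-1/r)" if "b > 0" "0 < \<epsilon>" "\<epsilon> < b powr (- real s * r)" for b \<epsilon>
  proof -
    have "b ^ Suc m = (b powr (- real s * r)) powr (-1/r)"
      using r \<open>b > 0\<close> unfolding powr_powr s by (simp add: powr_realpow del: of_nat_Suc power_Suc)
    also have "\<dots> < \<epsilon> powr (-1/r)" using that r by (intro powr_less_mono2_neg) auto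
    finally show ?thesis .
  qed
  have denom: "ln T + real s * (1 - ln b) - 1 = ln T - real (Suc m) * ln b + real m"
      "ln T + real s * (1 - ln b) = ln T - real (Suc m) * ln b + real (Suc m)" for T b
    by (simp_all add: s algebra_simps)
  have midpoint: "\<exists>\<epsilon>' \<in> {0<..1}. \<forall>\<alpha> > -1. \<forall>\<beta> > -1. a = (\<alpha> + \<beta> + 1) / 2 \<longrightarrow> (\<forall>\<epsilon> \<in> {0<..\<epsilon>'}.
        n a \<alpha> \<beta> \<epsilon> \<le> ereal (\<epsilon> powr (-1/r) * (ln (\<epsilon> powr (-1/r)) - s * ln (a - 1/2)) ^ s /
          (fact (s - 1) * (ln (\<epsilon> powr (-1/r)) + s * (1 - ln (a - 1/2)) - 1))))"
    if a: "a > 1/2" for a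
  proof -
    define b where "b = a - 1/2"
    have b: "b > 0" "a = b + 1/2" using a by (auto simp: b_def)
    obtain T0 where T0: "\<And>T. T \<ge> T0 \<Longrightarrow> real (hyp_count a (Suc m) T) \<le> cross_vol b m T"
      using hyp_count_le_cross_vol_midpoint[OF b(1) m] unfolding eventually_at_top_linorder b(2) by blast
    \<comment> \<open>The three entries ensure \<open>\<epsilon>' \<le> 1\<close>, the midpoint
      comparison, and the closed bound. They depend on \<open>a\<close> and \<open>s\<close> only,
      so one threshold serves all \<open>\<alpha>\<close> and \<open>\<beta>\<close> belonging to
      \<open>a\<close>.\<close>
    define T1 where "T1 = max 1 (max T0 (b ^ Suc m))"
    show ?thesis
    proof (intro bexI[of _ "T1 powr (- r)"] allI impI ballI)
      have "T1 powr (- r) \<le> 1 powr (- r)" using r by (intro powr_mono2') (auto simp: T1_def)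
      then show "T1 powr (- r) \<in> {0<..1}" by (auto simp: T1_def)
      fix \<alpha> \<beta> \<epsilon> :: real assume ab: "\<alpha> > -1" "\<beta> > -1" and \<epsilon>: "\<epsilon> \<in> {0<..T1 powr (- r)}"
      define T where "T = \<epsilon> powr (-1/r)"
      have "T1 = (T1 powr (- r)) powr (-1/r)" using r by (simp add: powr_powr T1_def)
      also have "\<dots> \<le> T" unfolding T_def using \<epsilon> r by (intro powr_mono2') auto
      finally have T: "T \<ge> T0" "T \<ge> b ^ Suc m" by (auto simp: T1_def)
      show "n a \<alpha> \<beta> \<epsilon> \<le> ereal (\<epsilon> powr (-1/r) * (ln (\<epsilon> powr (-1/r)) - s * ln (a - 1/2)) ^ s /
          (fact (s - 1) * (ln (\<epsilon> powr (-1/r)) + s * (1 - ln (a - 1/2)) - 1)))"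
      proof -
        have "real (hyp_count a (Suc m) T) \<le> T * (ln T - s * ln b) ^ s / (fact (s - 1) * (ln T + s * (1 - ln b) - 1))"
          using order_trans[OF T0[OF T(1)] cross_vol_bounds(1)[OF b(1) T(2) m]]
          unfolding denom(1) unfolding s diff_Suc_1 .
        then show ?thesis
          unfolding b_def T_def using a \<epsilon> by (subst n_eq[OF ab]) auto
      qed
    qed
  qed
  have upper: "n a \<alpha> \<beta> \<epsilon> \<le> ereal (\<epsilon> powr (-1/r) * (ln (\<epsilon> powr (-1/r)) - s * ln (a - 1)) ^ s /
          (fact (s - 1) * (ln (\<epsilon> powr (-1/r)) + s * (1 - ln (a - 1)) - 1)))"
    if a: "a > 1" and ab: "\<alpha> > -1" "\<beta> > -1" and \<epsilon>: "\<epsilon> \<in> {0<..<(a - 1) powr (- real s * r)}" for a \<alpha> \<beta> \<epsilon>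
  proof -
    define T where "T = \<epsilon> powr (-1/r)"
    have T: "T > 0" "(a - 1) ^ Suc m \<le> T" and a1: "a - 1 > 0"
      using large[of "a - 1" \<epsilon>] a \<epsilon> by (auto simp: T_def)
    have "real (hyp_count a (Suc m) T) \<le> T * (ln T - s * ln (a - 1)) ^ s /
          (fact (s - 1) * (ln T + s * (1 - ln (a - 1)) - 1))"
      using order_trans[OF hyp_count_le_cross_vol[OF a T(1)] cross_vol_bounds(1)[OF a1 T(2) m]]
      unfolding denom(1) unfolding s diff_Suc_1 .
    then show ?thesis unfolding T_def using a \<epsilon> by (subst n_eq[OF ab]) auto
  qed
  have lower: "n a \<alpha> \<beta> \<epsilon> \<ge> ereal (\<epsilon> powr (-1/r) * (ln (\<epsilon> powr (-1/r)) - s * ln a) ^ s /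
          (fact (s - 1) * (ln (\<epsilon> powr (-1/r)) + s * (1 - ln a))) - 1)"
    if a: "a > 0" and ab: "\<alpha> > -1" "\<beta> > -1" and \<epsilon>: "\<epsilon> \<in> {0<..<a powr (- real s * r)}" for a \<alpha> \<beta> \<epsilon>
  proof -
    define T where "T = \<epsilon> powr (-1/r)"
    have T: "T > 0" "a ^ Suc m \<le> T" using large[of a \<epsilon>] a \<epsilon> by (auto simp: T_def)
    have "T * (ln T - s * ln a) ^ s / (fact (s - 1) * (ln T + s * (1 - ln a))) \<le> real (hyp_count a (Suc m) T)"
      using order_trans[OF cross_vol_bounds(2)[OF a T(2)] hyp_count_ge_cross_vol[OF a T(1)]]
      unfolding denom(2) unfolding s diff_Suc_1 .
    then show ?thesis unfolding T_def using a \<epsilon> by (subst n_eq[OF ab]) auto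
  qed
  show ?thesis
    by (intro conjI allI impI ballI, erule midpoint, rule upper, assumption+, rule lower, assumption+)
qed

end
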